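(* Let $H$ be a Hopf algebra over $k$ and let $D\supseteq C_0$ be a Hopf subalgebra of $H$. Let $\{y_i\}_{i=1}^w$ be a set of skew primitive elements of $H$ such that (a) $\{y_i\}_{i=1}^w$ is linearly independent in the quotient space $H/D$; (b) for all $i\leq j$, $y_i\,\mu(y_j)=\lambda_{ij}\,\mu(y_j)\,y_i$ for some $\lambda_{ij}\in k^{\times}$; (c) for each $i$, $\lambda_{ii}$ is either $1$ or not a root of unity. Then $\operatorname{GKdim} H\geq \operatorname{GKdim} D+w$.
   Context: $k$ is an algebraically closed field of characteristic zero and everything is over $k$. For a Hopf algebra $H$ with coproduct $\Delta$, $G(H)$ is the group of group-like elements of $H$ and $C_0=kG(H)$ is its linear span. A nonzero element $y\in H$ is called skew primitive (always meaning $(1,g)$-primitive) if $\Delta(y)=y\otimes 1+g\otimes y$ for some $g$; then $g$ is group-like and uniquely determined by $y$, is called the weight of $y$, and is denoted $\mu(y)$. $\operatorname{GKdim}$ denotes Gelfand-Kirillov dimension, with values in $[0,\infty]$. *)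

theory Defs
  imports
    Complex_Main
    "HOL-Library.Poly_Mapping"
    "HOL-Library.Extended_Real"
    "HOL-Computational_Algebra.Polynomial"
begin

section \<open>Free vector spaces and tensor powers\<close>

text \<open>
  The type \<^typ>\<open>'a \<Rightarrow>\<^sub>0 'k\<close> is the vector space over \<open>'k\<close> with basis \<open>'a\<close>; the library provides its
  additive group but no scalar action.
\<close>

definition fscale :: "'k::field \<Rightarrow> ('a \<Rightarrow>\<^sub>0 'k) \<Rightarrow> ('a \<Rightarrow>\<^sub>0 'k)" where
  "fscale c t = Poly_Mapping.map ((*) c) t"

lemma lookup_fscale [simp]:
  "Poly_Mapping.lookup (fscale c t) a = c * Poly_Mapping.lookup t a"
  by (simp add: fscale_def Poly_Mapping.map.rep_eq when_def)

lemma vector_space_fscale: "vector_space (fscale :: 'k::field \<Rightarrow> ('a \<Rightarrow>\<^sub>0 'k) \<Rightarrow> _)"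
  by unfold_locales
    (simp_all add: poly_mapping_eq_iff fun_eq_iff lookup_add algebra_simps)

text \<open>
  Extension of a map \<open>f\<close> on the basis \<open>'a\<close> to a linear map from the free vector space to a
  vector space with scalar action \<open>sc\<close>.
\<close>

definition lin_ext ::
    "('k::field \<Rightarrow> 'b \<Rightarrow> 'b::ab_group_add) \<Rightarrow> ('a \<Rightarrow> 'b) \<Rightarrow> ('a \<Rightarrow>\<^sub>0 'k) \<Rightarrow> 'b" where
  "lin_ext sc f t = (\<Sum>a\<in>Poly_Mapping.keys t. sc (Poly_Mapping.lookup t a) (f a))"

text \<open>
  The scalar action \<open>scale\<close> on \<open>'h\<close> is a parameter, so the tensor square of \<open>'h\<close> cannot be formed as a
  type. An element of it is given by a representative in the free vector space on \<open>'h \<times> 'h\<close>, and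
  equality in the tensor square is equality of representatives modulo the span of the bilinearity
  relations; likewise for the tensor cube.
\<close>

definition tens :: "'h \<Rightarrow> 'h \<Rightarrow> ('h \<times> 'h \<Rightarrow>\<^sub>0 'k::field)" where
  "tens x y = Poly_Mapping.single (x, y) 1"

definition tens3 :: "'h \<Rightarrow> 'h \<Rightarrow> 'h \<Rightarrow> ('h \<times> 'h \<times> 'h \<Rightarrow>\<^sub>0 'k::field)" where
  "tens3 x y z = Poly_Mapping.single (x, y, z) 1"

definition bilinear_relations ::
    "('k::field \<Rightarrow> 'h \<Rightarrow> 'h::ab_group_add) \<Rightarrow> ('h \<times> 'h \<Rightarrow>\<^sub>0 'k) set" where
  "bilinear_relations scale =
     {tens (x + x') y - (tens x y + tens x' y) | x x' y. True} \<union>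
     {tens x (y + y') - (tens x y + tens x y') | x y y'. True} \<union>
     {tens (scale c x) y - fscale c (tens x y) | c x y. True} \<union>
     {tens x (scale c y) - fscale c (tens x y) | c x y. True}"

definition trilinear_relations ::
    "('k::field \<Rightarrow> 'h \<Rightarrow> 'h::ab_group_add) \<Rightarrow> ('h \<times> 'h \<times> 'h \<Rightarrow>\<^sub>0 'k) set" where
  "trilinear_relations scale =
     {tens3 (x + x') y z - (tens3 x y z + tens3 x' y z) | x x' y z. True} \<union>
     {tens3 x (y + y') z - (tens3 x y z + tens3 x y' z) | x y y' z. True} \<union>
     {tens3 x y (z + z') - (tens3 x y z + tens3 x y z') | x y z z'. True} \<union>
     {tens3 (scale c x) y z - fscale c (tens3 x y z) | c x y z. True} \<union>
     {tens3 x (scale c y) z - fscale c (tens3 x y z) | c x y z. True} \<union>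
     {tens3 x y (scale c z) - fscale c (tens3 x y z) | c x y z. True}"

definition tens_eq ::
    "('k::field \<Rightarrow> 'h \<Rightarrow> 'h::ab_group_add) \<Rightarrow> ('h \<times> 'h \<Rightarrow>\<^sub>0 'k) \<Rightarrow> ('h \<times> 'h \<Rightarrow>\<^sub>0 'k) \<Rightarrow> bool" where
  "tens_eq scale s t \<longleftrightarrow> s - t \<in> module.span fscale (bilinear_relations scale)"

definition tens3_eq ::
    "('k::field \<Rightarrow> 'h \<Rightarrow> 'h::ab_group_add) \<Rightarrow>
     ('h \<times> 'h \<times> 'h \<Rightarrow>\<^sub>0 'k) \<Rightarrow> ('h \<times> 'h \<times> 'h \<Rightarrow>\<^sub>0 'k) \<Rightarrow> bool" where
  "tens3_eq scale s t \<longleftrightarrow> s - t \<in> module.span fscale (trilinear_relations scale)"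

definition tens_mult ::
    "('h \<times> 'h \<Rightarrow>\<^sub>0 'k::field) \<Rightarrow> ('h \<times> 'h \<Rightarrow>\<^sub>0 'k) \<Rightarrow> ('h::times \<times> 'h \<Rightarrow>\<^sub>0 'k)" where
  "tens_mult s t =
     lin_ext fscale (\<lambda>(a, b). lin_ext fscale (\<lambda>(c, d). tens (a * c) (b * d)) t) s"


section \<open>Hopf algebras\<close>

locale k_algebra = vector_space scale
  for scale :: "'k::field \<Rightarrow> 'h::ring_1 \<Rightarrow> 'h" +
  assumes scale_mult_left: "scale c x * y = scale c (x * y)"
    and scale_mult_right: "x * scale c y = scale c (x * y)"

text \<open>
  \<open>\<Delta> x\<close> is a representative of the coproduct of \<open>x\<close>. All conditions on \<open>\<Delta>\<close> are invariant under the
  choice of representatives.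
\<close>

locale hopf_algebra = k_algebra scale
  for scale :: "'k::field \<Rightarrow> 'h::ring_1 \<Rightarrow> 'h" +
  fixes \<Delta> :: "'h \<Rightarrow> ('h \<times> 'h \<Rightarrow>\<^sub>0 'k)"
    and \<epsilon> :: "'h \<Rightarrow> 'k"
    and S :: "'h \<Rightarrow> 'h"
  assumes comult_add: "tens_eq scale (\<Delta> (x + y)) (\<Delta> x + \<Delta> y)"
    and comult_scale: "tens_eq scale (\<Delta> (scale c x)) (fscale c (\<Delta> x))"
    and comult_one: "tens_eq scale (\<Delta> 1) (tens 1 1)"
    and comult_mult: "tens_eq scale (\<Delta> (x * y)) (tens_mult (\<Delta> x) (\<Delta> y))"
    and counit_linear: "Vector_Spaces.linear scale (*) \<epsilon>"
    and counit_one: "\<epsilon> 1 = 1"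
    and counit_mult: "\<epsilon> (x * y) = \<epsilon> x * \<epsilon> y"
    and coassoc: "tens3_eq scale
      (lin_ext fscale (\<lambda>(a, b). lin_ext fscale (\<lambda>(a1, a2). tens3 a1 a2 b) (\<Delta> a)) (\<Delta> x))
      (lin_ext fscale (\<lambda>(a, b). lin_ext fscale (\<lambda>(b1, b2). tens3 a b1 b2) (\<Delta> b)) (\<Delta> x))"
    and counit_left: "lin_ext scale (\<lambda>(a, b). scale (\<epsilon> a) b) (\<Delta> x) = x"
    and counit_right: "lin_ext scale (\<lambda>(a, b). scale (\<epsilon> b) a) (\<Delta> x) = x"
    and antipode_linear: "Vector_Spaces.linear scale scale S"
    and antipode_left: "lin_ext scale (\<lambda>(a, b). S a * b) (\<Delta> x) = scale (\<epsilon> x) 1"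
    and antipode_right: "lin_ext scale (\<lambda>(a, b). a * S b) (\<Delta> x) = scale (\<epsilon> x) 1"

text \<open>
  The condition on \<open>\<Delta>\<close> says that it maps \<open>D\<close> into the image of the tensor square of \<open>D\<close>.
\<close>

definition hopf_subalgebra ::
    "('k::field \<Rightarrow> 'h \<Rightarrow> 'h::ring_1) \<Rightarrow> ('h \<Rightarrow> ('h \<times> 'h \<Rightarrow>\<^sub>0 'k)) \<Rightarrow> ('h \<Rightarrow> 'h) \<Rightarrow> 'h set \<Rightarrow> bool" where
  "hopf_subalgebra scale \<Delta> S D \<longleftrightarrow>
     module.subspace scale D \<and> 1 \<in> D \<and> (\<forall>x\<in>D. \<forall>y\<in>D. x * y \<in> D) \<and>
     (\<forall>x\<in>D. \<exists>t. Poly_Mapping.keys t \<subseteq> D \<times> D \<and> tens_eq scale (\<Delta> x) t) \<and>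
     (\<forall>x\<in>D. S x \<in> D)"

definition group_likes ::
    "('k::field \<Rightarrow> 'h \<Rightarrow> 'h::ring_1) \<Rightarrow> ('h \<Rightarrow> ('h \<times> 'h \<Rightarrow>\<^sub>0 'k)) \<Rightarrow> 'h set" where
  "group_likes scale \<Delta> = {g. g \<noteq> 0 \<and> tens_eq scale (\<Delta> g) (tens g g)}"

definition skew_primitive ::
    "('k::field \<Rightarrow> 'h \<Rightarrow> 'h::ring_1) \<Rightarrow> ('h \<Rightarrow> ('h \<times> 'h \<Rightarrow>\<^sub>0 'k)) \<Rightarrow> 'h \<Rightarrow> bool" where
  "skew_primitive scale \<Delta> y \<longleftrightarrow>
     y \<noteq> 0 \<and> (\<exists>g. tens_eq scale (\<Delta> y) (tens y 1 + tens g y))"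

definition weight ::
    "('k::field \<Rightarrow> 'h \<Rightarrow> 'h::ring_1) \<Rightarrow> ('h \<Rightarrow> ('h \<times> 'h \<Rightarrow>\<^sub>0 'k)) \<Rightarrow> 'h \<Rightarrow> 'h" where
  "weight scale \<Delta> y = (THE g. tens_eq scale (\<Delta> y) (tens y 1 + tens g y))"


section \<open>Linear independence in a quotient space\<close>

definition lin_indep_mod ::
    "('k::field \<Rightarrow> 'h \<Rightarrow> 'h::ab_group_add) \<Rightarrow> 'h set \<Rightarrow> 'i set \<Rightarrow> ('i \<Rightarrow> 'h) \<Rightarrow> bool" where
  "lin_indep_mod scale D I y \<longleftrightarrow>
     (\<forall>J c. finite J \<longrightarrow> J \<subseteq> I \<longrightarrow> (\<Sum>i\<in>J. scale (c i) (y i)) \<in> D \<longrightarrow> (\<forall>i\<in>J. c i = 0))"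


section \<open>Gelfand-Kirillov dimension\<close>

definition gk_growth :: "('k::field \<Rightarrow> 'h \<Rightarrow> 'h::ring_1) \<Rightarrow> 'h set \<Rightarrow> nat \<Rightarrow> nat" where
  "gk_growth scale V n =
     vector_space.dim scale (module.span scale {prod_list vs | vs. set vs \<subseteq> V \<and> length vs \<le> n})"

text \<open>
  \<open>A\<close> is a subalgebra of the ambient algebra; the supremum is over its finite-dimensional subspaces.
\<close>

definition GKdim :: "('k::field \<Rightarrow> 'h \<Rightarrow> 'h::ring_1) \<Rightarrow> 'h set \<Rightarrow> ereal" where
  "GKdim scale A =
     (SUP V \<in> {V. V \<subseteq> A \<and> (\<exists>B. finite B \<and> V = module.span scale B)}.
        limsup (\<lambda>n. ereal (log (real n) (real (gk_growth scale V n)))))"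

end

theory Submission
  imports Defs "HOL-Analysis.Extended_Real_Limits"
begin

text \<open>
  The bound holds because the ordered monomials \<open>y\<^sub>1\<^bsup>n\<^sub>1\<^esup> \<dots> y\<^sub>w\<^bsup>n\<^sub>w\<^esup>\<close> are left linearly independent
  over \<open>D\<close> (\<open>words_independent_over\<close>). Then, for a finite-dimensional \<open>V \<subseteq> D\<close>, the products of
  at most \<open>n\<close> factors from \<open>V\<close> times the monomials with exponents at most \<open>n\<close> have a span of
  dimension \<open>(n + 1)\<^sup>w\<close> times the dimension that \<open>V\<close> alone gives, within the products of
  length at most \<open>(w + 1) n\<close> from \<open>V\<close> and the \<open>y\<^sub>i\<close>. Each independent monomial exponent thus
  raises the growth exponent by one (\<open>GKdim_ge\<close>).

  Independence is shown by induction on the degree. Write \<open>g\<^sub>i = \<mu>(y\<^sub>i)\<close>. The skew commutation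
  relations for \<open>i \<le> j\<close> are what is needed to sort the terms of \<open>\<Delta>(y\<^sub>1\<^bsup>n\<^sub>1\<^esup> \<dots> y\<^sub>w\<^bsup>n\<^sub>w\<^esup>)\<close>: the coefficient
  of a monomial \<open>y\<^sup>m\<close> of degree one less in the right tensor factor is \<open>c g\<^sup>m y\<^sub>i\<close> if \<open>y\<^sup>m\<close> arises
  by deleting one factor \<open>y\<^sub>i\<close>, and zero otherwise. Here \<open>c\<close> is a product of some \<open>\<lambda>\<^sub>i\<^sub>j\<close> and of a \<open>q\<close>-number for
  \<open>q = \<lambda>\<^sub>i\<^sub>i\<close>, nonzero since \<open>q\<close> is \<open>1\<close> or not a root of unity and the characteristic is zero
  (\<open>coefficient_insert\<close>). Contracting \<open>\<Delta>\<close> of a relation over \<open>D\<close> with a form that reads off the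
  coefficient of \<open>y\<^sup>m\<close> therefore yields a relation \<open>\<Sum> e\<^sub>i y\<^sub>i \<in> D\<close> with \<open>e\<^sub>i \<in> D\<close>, where the coefficients
  of highest degree of the original relation appear in the \<open>e\<^sub>i\<close> up to invertible factors.

  Such a relation is trivial (\<open>skew_primitives_independent_over\<close>). This is the point where the
  antipode enters: the coproduct gives \<open>\<Sum> \<Delta>(e\<^sub>i g\<^sub>i) (1 \<otimes> g\<^sub>i\<^sup>-\<^sup>1 y\<^sub>i) = 0\<close> in \<open>D \<otimes> H/D\<close>, and the antipode
  undoes the coproduct of \<open>e\<^sub>i g\<^sub>i\<close>, as in the fundamental theorem of Hopf modules. It remains that
  the \<open>g\<^sub>i\<^sup>-\<^sup>1 y\<^sub>i\<close> are independent modulo \<open>D\<close>, which follows from the same property of the \<open>y\<^sub>i\<close> as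
  distinct group-like elements are not proportional.
\<close>


section \<open>Linear and bilinear forms\<close>

lemma vector_space_mult: "vector_space ((*) :: 'k::field \<Rightarrow> 'k \<Rightarrow> 'k)"
  by unfold_locales (simp_all add: algebra_simps)

text \<open>A separate locale, since declarations in \<open>vector_space\<close> itself would also be made for its
  interpretation by the real vector spaces, under the same names.\<close>

locale linear_space = vector_space scale
  for scale :: "'a::field \<Rightarrow> 'b::ab_group_add \<Rightarrow> 'b"
begin

definition linear_form :: "('b \<Rightarrow> 'a) \<Rightarrow> bool" where
  "linear_form f \<longleftrightarrow> (\<forall>x y. f (x + y) = f x + f y) \<and> (\<forall>c x. f (scale c x) = c * f x)"

definition bilinear_form :: "('b \<Rightarrow> 'b \<Rightarrow> 'a) \<Rightarrow> bool" where
  "bilinear_form B \<longleftrightarrow> (\<forall>x. linear_form (B x)) \<and> (\<forall>y. linear_form (\<lambda>x. B x y))"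

lemma linear_form_iff_linear: "linear_form f \<longleftrightarrow> Vector_Spaces.linear scale (*) f"
  using vector_space_axioms vector_space_mult by (auto simp: linear_form_def Vector_Spaces.linear_iff)

lemma linear_form_add: "linear_form f \<Longrightarrow> f (x + y) = f x + f y"
  and linear_form_scale: "linear_form f \<Longrightarrow> f (scale c x) = c * f x"
  by (simp_all add: linear_form_def)

lemma linear_form_0: "linear_form f \<Longrightarrow> f 0 = 0"
  using linear_form_scale[of f 0 0] by simp

lemma linear_form_diff: "linear_form f \<Longrightarrow> f (x - y) = f x - f y"
  using linear_form_add[of f "x - y" y] by (simp add: eq_diff_eq)

lemma linear_form_sum:
  assumes "linear_form f"
  shows "f (sum g A) = (\<Sum>a\<in>A. f (g a))"
  by (induct A rule: infinite_finite_induct)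
    (simp_all add: linear_form_0[OF assms] linear_form_add[OF assms])

lemma linear_form_const_0 [intro]: "linear_form (\<lambda>x. 0)"
  and linear_form_plus [intro]:
    "linear_form f \<Longrightarrow> linear_form h \<Longrightarrow> linear_form (\<lambda>x. f x + h x)"
  and linear_form_cmult [intro]: "linear_form f \<Longrightarrow> linear_form (\<lambda>x. c * f x)"
  and linear_form_multc [intro]: "linear_form f \<Longrightarrow> linear_form (\<lambda>x. f x * c)"
  by (simp_all add: linear_form_def algebra_simps)

lemma linear_form_compose:
  "linear_form f \<Longrightarrow> Vector_Spaces.linear scale scale p \<Longrightarrow> linear_form (\<lambda>x. f (p x))"
  by (simp add: linear_form_def Vector_Spaces.linear_iff)

lemma bilinear_formD:
  assumes "bilinear_form B"
  shows "linear_form (B x)" "linear_form (\<lambda>x. B x y)"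
  using assms by (simp_all add: bilinear_form_def)

lemma bilinear_formI:
  "(\<And>x. linear_form (B x)) \<Longrightarrow> (\<And>y. linear_form (\<lambda>x. B x y)) \<Longrightarrow> bilinear_form B"
  by (simp add: bilinear_form_def)

lemma bilinear_form_product:
  "linear_form f \<Longrightarrow> linear_form h \<Longrightarrow> bilinear_form (\<lambda>a b. f a * h b)"
  by (intro bilinear_formI linear_form_cmult linear_form_multc)

lemma linear_form_on_independent:
  assumes "independent B"
  obtains f where "linear_form f" "\<And>b. b \<in> B \<Longrightarrow> f b = h b"
proof -
  interpret vector_space_pair scale "(*) :: 'a \<Rightarrow> 'a \<Rightarrow> 'a"
    using vector_space_axioms vector_space_mult by (simp add: vector_space_pair_def)
  show ?thesis
    using linear_independent_extend[OF assms, of h] that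
    by (auto simp: linear_form_iff_linear)
qed

lemma linear_form_eq_on_span:
  assumes "linear_form f" "linear_form h" "\<And>b. b \<in> B \<Longrightarrow> f b = h b" "x \<in> span B"
  shows "f x = h x"
  using assms(4)
  by (induct rule: span_induct_alt)
    (simp_all add: assms(3) linear_form_0[OF assms(1)] linear_form_0[OF assms(2)]
      linear_form_add[OF assms(1)] linear_form_add[OF assms(2)]
      linear_form_scale[OF assms(1)] linear_form_scale[OF assms(2)])

text \<open>Linear forms detect membership in a subspace, so that statements about quotients by a
  subspace become statements about the forms vanishing on it.\<close>

lemma separating_linear_form:
  assumes "subspace U" "x \<notin> U"
  obtains f where "linear_form f" "\<And>u. u \<in> U \<Longrightarrow> f u = 0" "f x = 1"
proof -
  obtain B where B: "B \<subseteq> U" "independent B" "U \<subseteq> span B"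
    by (rule maximal_independent_subset[of U])
  have "x \<notin> span B"
    using span_minimal[OF B(1) assms(1)] assms(2) by auto
  then have "independent (insert x B)"
    by (intro independent_insertI B)
  then obtain f where f: "linear_form f"
      "\<And>b. b \<in> insert x B \<Longrightarrow> f b = (if b = x then 1 else 0)"
    by (rule linear_form_on_independent[where h = "\<lambda>b. if b = x then 1 else 0"]) blast
  have "f u = 0" if "u \<in> U" for u
  proof (rule linear_form_eq_on_span[OF f(1) linear_form_const_0])
    show "f b = 0" if "b \<in> B" for b
      using f(2)[of b] that B(1) assms(2) by auto
    show "u \<in> span B"
      using that B(3) by auto
  qed
  then show ?thesis
    using f that by simp
qed

lemma in_subspaceI_linear_forms:
  assumes "subspace U" "\<And>f. linear_form f \<Longrightarrow> (\<And>u. u \<in> U \<Longrightarrow> f u = 0) \<Longrightarrow> f x = 0"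
  shows "x \<in> U"
  using assms separating_linear_form by (metis zero_neq_one)

lemma eq_0I_linear_forms:
  assumes "\<And>f. linear_form f \<Longrightarrow> f x = 0"
  shows "x = 0"
  using in_subspaceI_linear_forms[OF subspace_single_0, of x] assms by auto

lemma projection_onto_subspace:
  assumes "subspace U"
  obtains p where "Vector_Spaces.linear scale scale p" "\<And>x. p x \<in> U" "\<And>u. u \<in> U \<Longrightarrow> p u = u"
proof -
  interpret vector_space_pair scale scale
    using vector_space_axioms by (simp add: vector_space_pair_def)
  obtain B where B: "B \<subseteq> U" "independent B" "U \<subseteq> span B"
    by (rule maximal_independent_subset[of U])
  obtain p where p: "Vector_Spaces.linear scale scale p" "\<forall>x\<in>B. p x = id x"
      "range p = span (id ` B)"
    using linear_independent_extend_subspace[OF B(2)] by blast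
  have "span B = U"
    using B assms by (simp add: span_subspace)
  moreover have "p u = u" if "u \<in> span B" for u
  proof -
    interpret p: Vector_Spaces.linear scale scale p by fact
    show ?thesis
      using that by (induct rule: span_induct_alt) (simp_all add: p.zero p.add p.scale p(2))
  qed
  ultimately show ?thesis
    using p(1,3) by (intro that[of p]) auto
qed

text \<open>A relation \<open>F s - F t = 0\<close> rules out repetitions, so that independence as a family
  gives injectivity as well.\<close>

lemma independent_familyI:
  assumes "\<And>T c. finite T \<Longrightarrow> T \<subseteq> A \<Longrightarrow> (\<Sum>t\<in>T. scale (c t) (F t)) = 0 \<Longrightarrow> \<forall>t\<in>T. c t = 0"
  shows "inj_on F A" "independent (F ` A)"
proof -
  show inj: "inj_on F A"
  proof (rule inj_onI, rule ccontr)
    fix s t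
    assume st: "s \<in> A" "t \<in> A" "F s = F t" "s \<noteq> t"
    show False
      using assms[of "{s, t}" "\<lambda>r. if r = s then 1 else - 1"] st by simp
  qed
  show "independent (F ` A)"
    unfolding independent_explicit_finite_subsets
  proof (intro allI impI)
    fix R c
    assume R: "R \<subseteq> F ` A" "finite R" and sum0: "(\<Sum>v\<in>R. scale (c v) v) = 0"
    obtain T where T: "T \<subseteq> A" "finite T" "R = F ` T"
      using R finite_subset_image by metis
    have "(\<Sum>t\<in>T. scale (c (F t)) (F t)) = 0"
      using sum0 T inj_on_subset[OF inj T(1)] by (simp add: sum.reindex)
    then show "\<forall>v\<in>R. c v = 0"
      using assms[of T "\<lambda>t. c (F t)"] T by auto
  qed
qed

end


sublocale k_algebra \<subseteq> linear_space ..


section \<open>Sweedler sums\<close>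

lemma linear_space_fscale: "linear_space (fscale :: 'k::field \<Rightarrow> ('a \<Rightarrow>\<^sub>0 'k) \<Rightarrow> _)"
  by (simp add: linear_space_def vector_space_fscale)

text \<open>Instead of tensors, the proof works with the values of bilinear forms on them:
  \<open>sweedler B x\<close> below is the Sweedler sum \<open>\<Sum> B(x\<^sub>1, x\<^sub>2)\<close>. It is independent of the chosen
  representative of \<open>\<Delta> x\<close>, and it is linear in \<open>x\<close> although \<open>\<Delta>\<close> on representatives is not.\<close>

lemma lin_ext_superset:
  assumes "vector_space sc" "finite A" "Poly_Mapping.keys t \<subseteq> A"
  shows "lin_ext sc f t = (\<Sum>a\<in>A. sc (Poly_Mapping.lookup t a) (f a))"
proof -
  interpret vector_space sc by fact
  show ?thesis
    unfolding lin_ext_def using assms(2,3)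
    by (intro sum.mono_neutral_left) (auto simp: in_keys_iff)
qed

lemma linear_lin_ext:
  assumes "vector_space sc"
  shows "Vector_Spaces.linear fscale sc (lin_ext sc f)"
proof -
  interpret vector_space sc by fact
  have "lin_ext sc f (s + t) = lin_ext sc f s + lin_ext sc f t" for s t
  proof -
    let ?A = "Poly_Mapping.keys s \<union> Poly_Mapping.keys t"
    have "lin_ext sc f (s + t) = (\<Sum>a\<in>?A. sc (Poly_Mapping.lookup (s + t) a) (f a))"
      using Poly_Mapping.keys_add[of s t] by (intro lin_ext_superset[OF assms]) simp_all
    also have "\<dots> = lin_ext sc f s + lin_ext sc f t"
      by (simp add: lin_ext_superset[OF assms, of ?A] lookup_add scale_left_distrib sum.distrib)
    finally show ?thesis .
  qed
  moreover have "lin_ext sc f (fscale c t) = sc c (lin_ext sc f t)" for c t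
  proof -
    have "Poly_Mapping.keys (fscale c t) \<subseteq> Poly_Mapping.keys t"
      by (auto simp: in_keys_iff)
    then show ?thesis
      by (simp add: lin_ext_superset[OF assms finite_keys[of t]] scale_sum_right)
  qed
  ultimately show ?thesis
    by (simp add: Vector_Spaces.linear_iff vector_space_fscale assms)
qed

lemma lin_ext_single:
  assumes "vector_space sc"
  shows "lin_ext sc f (Poly_Mapping.single a c) = sc c (f a)"
  using lin_ext_superset[OF assms, of "{a}" "Poly_Mapping.single a c" f] by simp

lemma linear_lin_ext_comp:
  assumes "Vector_Spaces.linear sc sc' h"
  shows "h (lin_ext sc f t) = lin_ext sc' (\<lambda>a. h (f a)) t"
proof -
  interpret Vector_Spaces.linear sc sc' h by fact
  show ?thesis
    by (simp add: lin_ext_def sum scale)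
qed

lemma lin_ext_cong:
  "(\<And>a. a \<in> Poly_Mapping.keys t \<Longrightarrow> f a = h a) \<Longrightarrow> lin_ext sc f t = lin_ext sc h t"
  by (simp add: lin_ext_def)

abbreviation pairing :: "('a \<Rightarrow> 'b \<Rightarrow> 'k) \<Rightarrow> ('a \<times> 'b \<Rightarrow>\<^sub>0 'k::field) \<Rightarrow> 'k" where
  "pairing B \<equiv> lin_ext (*) (\<lambda>(a, b). B a b)"

lemma linear_pairing: "Vector_Spaces.linear fscale (*) (lin_ext (*) F)"
  by (rule linear_lin_ext[OF vector_space_mult])

lemma pairing_add: "lin_ext (*) F (s + t) = lin_ext (*) F s + lin_ext (*) F t"
  and pairing_diff: "lin_ext (*) F (s - t) = lin_ext (*) F s - lin_ext (*) F t"
  and pairing_fscale: "lin_ext (*) F (fscale c t) = c * lin_ext (*) F t"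
proof -
  interpret Vector_Spaces.linear fscale "(*)" "lin_ext (*) F"
    by (rule linear_pairing)
  show "lin_ext (*) F (s + t) = lin_ext (*) F s + lin_ext (*) F t"
    "lin_ext (*) F (s - t) = lin_ext (*) F s - lin_ext (*) F t"
    "lin_ext (*) F (fscale c t) = c * lin_ext (*) F t"
    by (fact add diff scale)+
qed

lemma pairing_tens [simp]: "lin_ext (*) F (tens x y) = F (x, y)"
  by (simp add: tens_def lin_ext_single[OF vector_space_mult])

lemma pairing_tens3 [simp]: "lin_ext (*) F (tens3 x y z) = F (x, y, z)"
  by (simp add: tens3_def lin_ext_single[OF vector_space_mult])

lemma pairing_form_add:
  "lin_ext (*) (\<lambda>a. F a + G a) t = lin_ext (*) F t + lin_ext (*) G t"
  by (simp add: lin_ext_def sum.distrib distrib_left)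

lemma pairing_form_cmult: "lin_ext (*) (\<lambda>a. c * F a) t = c * lin_ext (*) F t"
  by (simp add: lin_ext_def sum_distrib_left mult.left_commute)

context linear_space
begin

lemma linear_form_fscale_iff:
  "linear_space.linear_form fscale F \<longleftrightarrow> Vector_Spaces.linear fscale (*) F"
  for F :: "('c \<Rightarrow>\<^sub>0 'a) \<Rightarrow> 'a"
  by (rule linear_space.linear_form_iff_linear[OF linear_space_fscale])

lemma pairing_eq_if_tens_eq:
  assumes "tens_eq scale s t" "bilinear_form B"
  shows "pairing B s = pairing B t"
proof -
  interpret f: linear_space "fscale :: 'a \<Rightarrow> ('b \<times> 'b \<Rightarrow>\<^sub>0 'a) \<Rightarrow> _"
    by (rule linear_space_fscale)
  have "pairing B r = 0" if "r \<in> f.span (bilinear_relations scale)" for r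
  proof (rule f.linear_form_eq_on_span[OF _ _ _ that])
    show "f.linear_form (pairing B)"
      by (simp add: linear_form_fscale_iff linear_pairing)
    show "f.linear_form (\<lambda>x. 0)" ..
    show "pairing B b = 0" if "b \<in> bilinear_relations scale" for b
      using that
      by (auto simp: bilinear_relations_def pairing_add pairing_diff pairing_fscale
          linear_form_add[OF bilinear_formD(1)[OF assms(2)]]
          linear_form_scale[OF bilinear_formD(1)[OF assms(2)]]
          linear_form_add[OF bilinear_formD(2)[OF assms(2)]]
          linear_form_scale[OF bilinear_formD(2)[OF assms(2)]])
  qed
  from this[of "s - t"] show ?thesis
    using assms(1) by (simp add: tens_eq_def pairing_diff)
qed

lemma pairing_eq_if_tens3_eq:
  assumes "tens3_eq scale s t"
    and "\<And>b c. linear_form (\<lambda>a. T a b c)" "\<And>a c. linear_form (\<lambda>b. T a b c)"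
      "\<And>a b. linear_form (\<lambda>c. T a b c)"
  shows "lin_ext (*) (\<lambda>(a, b, c). T a b c) s = lin_ext (*) (\<lambda>(a, b, c). T a b c) t"
proof -
  interpret f: linear_space "fscale :: 'a \<Rightarrow> ('b \<times> 'b \<times> 'b \<Rightarrow>\<^sub>0 'a) \<Rightarrow> _"
    by (rule linear_space_fscale)
  have "lin_ext (*) (\<lambda>(a, b, c). T a b c) r = 0" if "r \<in> f.span (trilinear_relations scale)" for r
  proof (rule f.linear_form_eq_on_span[OF _ _ _ that])
    show "f.linear_form (lin_ext (*) (\<lambda>(a, b, c). T a b c))"
      by (simp add: linear_form_fscale_iff linear_pairing)
    show "f.linear_form (\<lambda>x. 0)" ..
    show "lin_ext (*) (\<lambda>(a, b, c). T a b c) b = 0" if "b \<in> trilinear_relations scale" for b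
      using that
      by (auto simp: trilinear_relations_def pairing_add pairing_diff pairing_fscale
          linear_form_add[OF assms(2)] linear_form_add[OF assms(3)] linear_form_add[OF assms(4)]
          linear_form_scale[OF assms(2)] linear_form_scale[OF assms(3)]
          linear_form_scale[OF assms(4)])
  qed
  from this[of "s - t"] show ?thesis
    using assms(1) by (simp add: tens3_eq_def pairing_diff)
qed

text \<open>A linear form on the free vector space that vanishes on the bilinearity relations is the
  pairing with a bilinear form, so representatives of different tensors are told apart by some
  bilinear form.\<close>

lemma tens_eqI_pairing:
  assumes "\<And>B. bilinear_form B \<Longrightarrow> pairing B s = pairing B t"
  shows "tens_eq scale s t"
proof -
  interpret f: linear_space "fscale :: 'a \<Rightarrow> ('b \<times> 'b \<Rightarrow>\<^sub>0 'a) \<Rightarrow> _"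
    by (rule linear_space_fscale)
  have "s - t \<in> f.span (bilinear_relations scale)"
  proof (rule f.in_subspaceI_linear_forms)
    fix F
    assume F: "f.linear_form F" and F0: "\<And>u. u \<in> f.span (bilinear_relations scale) \<Longrightarrow> F u = 0"
    note F_simps = f.linear_form_add[OF F] f.linear_form_diff[OF F] f.linear_form_scale[OF F]
    have rel: "F u = F v" if "u - v \<in> bilinear_relations scale" for u v
      using F0[OF f.span_base[OF that]] by (simp add: F_simps)
    have "F (tens (x + x') y) = F (tens x y + tens x' y)"
        "F (tens x (y + y')) = F (tens x y + tens x y')"
        "F (tens (scale c x) y) = F (fscale c (tens x y))"
        "F (tens x (scale c y)) = F (fscale c (tens x y))" for x x' y y' c
      by (intro rel; unfold bilinear_relations_def; blast)+
    then have "bilinear_form (\<lambda>a b. F (tens a b))"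
      by (simp add: bilinear_form_def linear_form_def F_simps)
    then have "pairing (\<lambda>a b. F (tens a b)) s = pairing (\<lambda>a b. F (tens a b)) t"
      by (rule assms)
    moreover have "pairing (\<lambda>a b. F (tens a b)) r = F r" for r
    proof -
      have "r = lin_ext fscale (\<lambda>(a, b). tens a b) r"
        by (rule poly_mapping_eqI)
          (auto simp: lin_ext_def tens_def lookup_sum lookup_single when_def in_keys_iff
            if_distrib[of "\<lambda>x. _ * x"] cong: if_cong)
      then have "F r = F (lin_ext fscale (\<lambda>(a, b). tens a b) r)"
        by simp
      also have "\<dots> = pairing (\<lambda>a b. F (tens a b)) r"
        using F unfolding linear_form_fscale_iff
        by (subst linear_lin_ext_comp) (auto intro!: lin_ext_cong)
      finally show ?thesis by simp
    qed
    ultimately show "F (s - t) = 0"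
      by (simp add: F_simps)
  qed (rule f.subspace_span)
  then show ?thesis
    by (simp add: tens_eq_def)
qed

end

context hopf_algebra
begin

definition sweedler :: "('h \<Rightarrow> 'h \<Rightarrow> 'k) \<Rightarrow> 'h \<Rightarrow> 'k" where
  "sweedler B x = pairing B (\<Delta> x)"

lemma linear_form_mult_left: "linear_form f \<Longrightarrow> linear_form (\<lambda>x. f (z * x))"
  and linear_form_mult_right: "linear_form f \<Longrightarrow> linear_form (\<lambda>x. f (x * z))"
  by (simp_all add: linear_form_def algebra_simps scale_mult_left scale_mult_right)

lemma linear_form_counit: "linear_form \<epsilon>"
  using counit_linear by (simp add: linear_form_iff_linear)

lemma linear_form_antipode: "linear_form f \<Longrightarrow> linear_form (\<lambda>x. f (S x))"
  by (rule linear_form_compose[OF _ antipode_linear])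

lemma linear_form_sweedler:
  assumes "bilinear_form B"
  shows "linear_form (sweedler B)"
  unfolding linear_form_def sweedler_def
  using pairing_eq_if_tens_eq[OF comult_add assms] pairing_eq_if_tens_eq[OF comult_scale assms]
  by (simp add: pairing_add pairing_fscale)

lemma linear_form_sweedler_parameter:
  assumes "\<And>a b. linear_form (\<lambda>x. B x a b)"
  shows "linear_form (\<lambda>x. sweedler (B x) z)"
  unfolding linear_form_def sweedler_def
  by (simp add: linear_form_add[OF assms] linear_form_scale[OF assms] case_prod_beta'
      pairing_form_add pairing_form_cmult)

lemma sweedler_form_cmult: "sweedler (\<lambda>a b. c * B a b) x = c * sweedler B x"
  by (simp add: sweedler_def case_prod_beta' pairing_form_cmult)

lemma sweedler_form_0: "sweedler (\<lambda>a b. 0) x = 0"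
  by (simp add: sweedler_def lin_ext_def case_prod_beta')

lemma sweedler_form_sum_list:
  "sweedler (\<lambda>a b. \<Sum>r\<leftarrow>rs. B r a b) x = (\<Sum>r\<leftarrow>rs. sweedler (B r) x)"
  by (induct rs)
    (simp_all add: sweedler_def case_prod_beta' lin_ext_def distrib_left sum.distrib)

lemma sweedler_eq_pairing:
  "tens_eq scale (\<Delta> x) t \<Longrightarrow> bilinear_form B \<Longrightarrow> sweedler B x = pairing B t"
  by (simp add: sweedler_def pairing_eq_if_tens_eq)

lemma sweedler_one: "bilinear_form B \<Longrightarrow> sweedler B 1 = B 1 1"
  by (simp add: sweedler_eq_pairing[OF comult_one])

lemma pairing_tens_mult:
  "pairing B (tens_mult s t) = pairing (\<lambda>a b. pairing (\<lambda>c d. B (a * c) (b * d)) t) s"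
proof -
  have "pairing B (tens_mult s t) =
      lin_ext (*) (\<lambda>p. pairing B ((\<lambda>(a, b). lin_ext fscale
        (\<lambda>(c, d). tens (a * c) (b * d)) t) p)) s"
    unfolding tens_mult_def by (rule linear_lin_ext_comp[OF linear_pairing])
  also have "\<dots> = pairing (\<lambda>a b. pairing (\<lambda>c d. B (a * c) (b * d)) t) s"
    by (auto simp: linear_lin_ext_comp[OF linear_pairing] intro!: lin_ext_cong)
  finally show ?thesis .
qed

lemma sweedler_mult:
  assumes "bilinear_form B"
  shows "sweedler B (x * y) = sweedler (\<lambda>a b. sweedler (\<lambda>c d. B (a * c) (b * d)) y) x"
  using sweedler_eq_pairing[OF comult_mult assms] by (simp add: sweedler_def pairing_tens_mult)

lemma sweedler_coassoc:
  assumes "\<And>b c. linear_form (\<lambda>a. T a b c)" "\<And>a c. linear_form (\<lambda>b. T a b c)"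
    "\<And>a b. linear_form (\<lambda>c. T a b c)"
  shows "sweedler (\<lambda>a c. sweedler (\<lambda>a1 a2. T a1 a2 c) a) x =
    sweedler (\<lambda>a b. sweedler (\<lambda>b1 b2. T a b1 b2) b) x"
proof -
  let ?T = "lin_ext (*) (\<lambda>(a, b, c). T a b c)"
  have outer: "?T (lin_ext fscale F (\<Delta> x)) = lin_ext (*) (\<lambda>p. ?T (F p)) (\<Delta> x)" for F
    by (rule linear_lin_ext_comp[OF linear_pairing])
  have inner: "?T (lin_ext fscale F (\<Delta> z)) = lin_ext (*) (\<lambda>p. ?T (F p)) (\<Delta> z)" for F z
    by (rule linear_lin_ext_comp[OF linear_pairing])
  have "sweedler (\<lambda>a c. sweedler (\<lambda>a1 a2. T a1 a2 c) a) x = ?T (lin_ext fscale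
      (\<lambda>(a, b). lin_ext fscale (\<lambda>(a1, a2). tens3 a1 a2 b) (\<Delta> a)) (\<Delta> x))"
    unfolding outer sweedler_def
    by (auto simp: inner intro!: lin_ext_cong)
  also have "\<dots> = ?T (lin_ext fscale
      (\<lambda>(a, b). lin_ext fscale (\<lambda>(b1, b2). tens3 a b1 b2) (\<Delta> b)) (\<Delta> x))"
    by (rule pairing_eq_if_tens3_eq[OF coassoc assms])
  also have "\<dots> = sweedler (\<lambda>a b. sweedler (\<lambda>b1 b2. T a b1 b2) b) x"
    unfolding outer sweedler_def
    by (auto simp: inner intro!: lin_ext_cong)
  finally show ?thesis .
qed

lemma bilinear_form_plus:
  "bilinear_form B \<Longrightarrow> bilinear_form B' \<Longrightarrow> bilinear_form (\<lambda>a b. B a b + B' a b)"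
  by (intro bilinear_formI linear_form_plus; rule bilinear_formD)

lemma bilinear_form_translate_left:
  "bilinear_form B \<Longrightarrow> bilinear_form (\<lambda>c d. B (a * c) (b * d))"
  by (rule bilinear_formI, rule linear_form_mult_left[of "B _"], erule bilinear_formD,
      rule linear_form_mult_left[of "\<lambda>x. B x _"], erule bilinear_formD)

lemma bilinear_form_translate_right:
  "bilinear_form B \<Longrightarrow> bilinear_form (\<lambda>a b. B (a * c) (b * d))"
  by (rule bilinear_formI, rule linear_form_mult_right[of "B _"], erule bilinear_formD,
      rule linear_form_mult_right[of "\<lambda>x. B x _"], erule bilinear_formD)

lemma linear_form_lin_ext:
  assumes "linear_form f"
  shows "f (lin_ext scale F t) = lin_ext (*) (\<lambda>a. f (F a)) t"
  using assms unfolding linear_form_iff_linear by (rule linear_lin_ext_comp)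

lemma sweedler_counit_left:
  assumes "linear_form f"
  shows "sweedler (\<lambda>a b. \<epsilon> a * f b) x = f x"
proof -
  have "f x = f (lin_ext scale (\<lambda>(a, b). scale (\<epsilon> a) b) (\<Delta> x))"
    by (simp add: counit_left)
  also have "\<dots> = sweedler (\<lambda>a b. \<epsilon> a * f b) x"
    unfolding linear_form_lin_ext[OF assms] sweedler_def
    by (auto simp: linear_form_scale[OF assms] intro!: lin_ext_cong)
  finally show ?thesis by simp
qed

lemma sweedler_counit_right:
  assumes "linear_form f"
  shows "sweedler (\<lambda>a b. f a * \<epsilon> b) x = f x"
proof -
  have "f x = f (lin_ext scale (\<lambda>(a, b). scale (\<epsilon> b) a) (\<Delta> x))"
    by (simp add: counit_right)
  also have "\<dots> = sweedler (\<lambda>a b. f a * \<epsilon> b) x"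
    unfolding linear_form_lin_ext[OF assms] sweedler_def
    by (auto simp: linear_form_scale[OF assms] mult.commute intro!: lin_ext_cong)
  finally show ?thesis by simp
qed

lemma sweedler_antipode_left:
  assumes "linear_form f"
  shows "sweedler (\<lambda>a b. f (S a * b)) x = \<epsilon> x * f 1"
proof -
  have "\<epsilon> x * f 1 = f (lin_ext scale (\<lambda>(a, b). S a * b) (\<Delta> x))"
    by (simp add: antipode_left linear_form_scale[OF assms])
  also have "\<dots> = sweedler (\<lambda>a b. f (S a * b)) x"
    unfolding linear_form_lin_ext[OF assms] sweedler_def
    by (auto intro!: lin_ext_cong)
  finally show ?thesis by simp
qed

lemma sweedler_antipode_right:
  assumes "linear_form f"
  shows "sweedler (\<lambda>a b. f (a * S b)) x = \<epsilon> x * f 1"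
proof -
  have "\<epsilon> x * f 1 = f (lin_ext scale (\<lambda>(a, b). a * S b) (\<Delta> x))"
    by (simp add: antipode_right linear_form_scale[OF assms])
  also have "\<dots> = sweedler (\<lambda>a b. f (a * S b)) x"
    unfolding linear_form_lin_ext[OF assms] sweedler_def
    by (auto intro!: lin_ext_cong)
  finally show ?thesis by simp
qed

text \<open>On a subcoalgebra \<open>D\<close>, a Sweedler sum only depends on the restriction of the form to \<open>D\<close>;
  the two forms may be arbitrary extensions of it.\<close>

lemma sweedler_cong_subcoalgebra:
  assumes "hopf_subalgebra scale \<Delta> S D" "x \<in> D" "bilinear_form B" "bilinear_form B'"
    and "\<And>a b. a \<in> D \<Longrightarrow> b \<in> D \<Longrightarrow> B a b = B' a b"
  shows "sweedler B x = sweedler B' x"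
proof -
  obtain t where t: "Poly_Mapping.keys t \<subseteq> D \<times> D" "tens_eq scale (\<Delta> x) t"
    using assms(1,2) by (auto simp: hopf_subalgebra_def)
  have "pairing B t = pairing B' t"
    using t(1) assms(5) by (auto intro!: lin_ext_cong)
  then show ?thesis
    using assms(3,4) by (simp add: sweedler_eq_pairing[OF t(2)])
qed


section \<open>Group-like and skew primitive elements\<close>

lemma sweedler_group_like:
  "tens_eq scale (\<Delta> g) (tens g g) \<Longrightarrow> bilinear_form B \<Longrightarrow> sweedler B g = B g g"
  by (simp add: sweedler_eq_pairing)

lemma sweedler_skew_primitive:
  "tens_eq scale (\<Delta> y) (tens y 1 + tens g y) \<Longrightarrow> bilinear_form B \<Longrightarrow>
    sweedler B y = B y 1 + B g y"
  by (simp add: sweedler_eq_pairing pairing_add)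

lemma nonzero_linear_form:
  assumes "x \<noteq> 0"
  obtains f where "linear_form f" "f x = 1"
  using separating_linear_form[OF subspace_single_0, of x] assms by auto

text \<open>The coproduct of \<open>y\<close> determines \<open>g \<otimes> y\<close>, hence \<open>g\<close>.\<close>

lemma weight_eq:
  assumes "y \<noteq> 0" "tens_eq scale (\<Delta> y) (tens y 1 + tens g y)"
  shows "weight scale \<Delta> y = g"
  unfolding weight_def
proof (rule the_equality)
  show "tens_eq scale (\<Delta> y) (tens y 1 + tens g y)" by fact
  fix g'
  assume g': "tens_eq scale (\<Delta> y) (tens y 1 + tens g' y)"
  obtain f where f: "linear_form f" "f y = 1"
    using nonzero_linear_form[OF assms(1)] .
  have "g' - g = 0"
  proof (rule eq_0I_linear_forms)
    fix e
    assume e: "linear_form e"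
    show "e (g' - g) = 0"
      using sweedler_skew_primitive[OF g' bilinear_form_product[OF e f(1)]]
        sweedler_skew_primitive[OF assms(2) bilinear_form_product[OF e f(1)]]
      by (simp add: f linear_form_diff[OF e])
  qed
  then show "g' = g" by simp
qed

text \<open>Coassociativity at \<open>y\<close> compares \<open>\<Delta> g \<otimes> y\<close> with \<open>g \<otimes> g \<otimes> y\<close>.\<close>

lemma weight_comult:
  assumes "y \<noteq> 0" "tens_eq scale (\<Delta> y) (tens y 1 + tens g y)"
  shows "tens_eq scale (\<Delta> g) (tens g g)"
proof (rule tens_eqI_pairing)
  fix B
  assume B: "bilinear_form B"
  note B' = bilinear_formD[OF B]
  obtain f where f: "linear_form f" "f y = 1"
    using nonzero_linear_form[OF assms(1)] .
  let ?T = "\<lambda>a b c. B a b * f c"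
  note sw = sweedler_skew_primitive[OF assms(2)]
  have "sweedler (\<lambda>a c. sweedler (\<lambda>a1 a2. ?T a1 a2 c) a) y =
      sweedler (\<lambda>a1 a2. ?T a1 a2 1) y + sweedler (\<lambda>a1 a2. ?T a1 a2 y) g"
    by (rule sw) (intro bilinear_formI linear_form_sweedler linear_form_sweedler_parameter
        linear_form_multc linear_form_cmult B' f)
  also have "\<dots> = f 1 * (B y 1 + B g y) + sweedler B g"
    using sw[OF B] by (simp add: f sweedler_form_cmult mult.commute[of _ "f _"])
  finally have l: "sweedler (\<lambda>a c. sweedler (\<lambda>a1 a2. ?T a1 a2 c) a) y =
      f 1 * (B y 1 + B g y) + sweedler B g" .
  have "sweedler (\<lambda>a b. sweedler (\<lambda>b1 b2. ?T a b1 b2) b) y =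
      sweedler (\<lambda>b1 b2. ?T y b1 b2) 1 + sweedler (\<lambda>b1 b2. ?T g b1 b2) y"
    by (rule sw) (intro bilinear_formI linear_form_sweedler linear_form_sweedler_parameter
        linear_form_multc linear_form_cmult B' f)
  also have "\<dots> = B y 1 * f 1 + (B g y * f 1 + B g g * f y)"
    using sweedler_one[OF bilinear_form_product[OF B'(1) f(1)], of y]
      sw[OF bilinear_form_product[OF B'(1) f(1)], of g] by simp
  finally have r: "sweedler (\<lambda>a b. sweedler (\<lambda>b1 b2. ?T a b1 b2) b) y =
      B y 1 * f 1 + (B g y * f 1 + B g g * f y)" .
  have "sweedler (\<lambda>a c. sweedler (\<lambda>a1 a2. ?T a1 a2 c) a) y =
      sweedler (\<lambda>a b. sweedler (\<lambda>b1 b2. ?T a b1 b2) b) y"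
    by (rule sweedler_coassoc) (intro linear_form_multc linear_form_cmult B' f)+
  then have "sweedler B g = B g g"
    unfolding l r by (simp add: f algebra_simps)
  then show "pairing B (\<Delta> g) = pairing B (tens g g)"
    by (simp add: sweedler_def)
qed

text \<open>A scalar \<open>y = c\<close> is skew primitive of weight \<open>0\<close>, so it has to be excluded: for weight
  \<open>0\<close>, the counit axiom turns \<open>\<Delta> y = y \<otimes> 1\<close> into \<open>y = \<epsilon>(y) 1\<close>.\<close>

lemma weight_nonzero:
  assumes "y \<notin> range (\<lambda>c. scale c 1)" "tens_eq scale (\<Delta> y) (tens y 1 + tens g y)"
  shows "g \<noteq> 0"
proof
  assume "g = 0"
  have "y - scale (\<epsilon> y) 1 = 0"
  proof (rule eq_0I_linear_forms)
    fix f
    assume f: "linear_form f"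
    have "f y = \<epsilon> y * f 1 + \<epsilon> g * f y"
      using sweedler_skew_primitive[OF assms(2) bilinear_form_product[OF linear_form_counit f]]
        sweedler_counit_left[OF f] by simp
    then show "f (y - scale (\<epsilon> y) 1) = 0"
      by (simp add: \<open>g = 0\<close> linear_form_diff[OF f] linear_form_scale[OF f]
          linear_form_0[OF linear_form_counit])
  qed
  then have "y = scale (\<epsilon> y) 1" by simp
  then show False
    using assms(1) by blast
qed

lemma bilinear_form_antipode_mult:
  "linear_form f \<Longrightarrow> bilinear_form (\<lambda>a b. f (S a * b))"
  "linear_form f \<Longrightarrow> bilinear_form (\<lambda>a b. f (a * S b))"
  by (intro bilinear_formI linear_form_mult_left linear_form_mult_right
      linear_form_antipode[of "\<lambda>x. f (x * _)"] linear_form_antipode[of "\<lambda>x. f (_ * x)"];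
      assumption)+

context
  fixes g
  assumes nonzero: "g \<noteq> 0" and comult: "tens_eq scale (\<Delta> g) (tens g g)"
begin

lemma group_like_counit: "\<epsilon> g = 1"
proof -
  obtain f where f: "linear_form f" "f g = 1"
    using nonzero_linear_form[OF nonzero] .
  show ?thesis
    using sweedler_group_like[OF comult bilinear_form_product[OF linear_form_counit f(1)]]
      sweedler_counit_left[OF f(1)] f(2) by simp
qed

lemma antipode_group_like_left: "S g * g = 1"
proof -
  have "S g * g - 1 = 0"
  proof (rule eq_0I_linear_forms)
    fix f
    assume f: "linear_form f"
    show "f (S g * g - 1) = 0"
      using sweedler_antipode_left[OF f, of g]
        sweedler_group_like[OF comult bilinear_form_antipode_mult(1)[OF f]]
      by (simp add: group_like_counit linear_form_diff[OF f])
  qed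
  then show ?thesis by simp
qed

lemma antipode_group_like_right: "g * S g = 1"
proof -
  have "g * S g - 1 = 0"
  proof (rule eq_0I_linear_forms)
    fix f
    assume f: "linear_form f"
    show "f (g * S g - 1) = 0"
      using sweedler_antipode_right[OF f, of g]
        sweedler_group_like[OF comult bilinear_form_antipode_mult(2)[OF f]]
      by (simp add: group_like_counit linear_form_diff[OF f])
  qed
  then show ?thesis by simp
qed

text \<open>Multiply \<open>\<Delta> g * \<Delta> (S g) = \<Delta> 1 = 1 \<otimes> 1\<close> by \<open>S g \<otimes> S g\<close> on the left.\<close>

lemma sweedler_antipode_group_like:
  assumes B: "bilinear_form B"
  shows "sweedler B (S g) = B (S g) (S g)"
proof -
  note B' = bilinear_formD[OF B]
  have cancel: "S g * (g * x) = x" for x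
    by (simp add: antipode_group_like_left flip: mult.assoc)
  let ?B = "\<lambda>a b. B (S g * a) (S g * b)"
  have bil: "bilinear_form ?B"
    by (intro bilinear_formI linear_form_mult_left[of "B _"]
        linear_form_mult_left[of "\<lambda>x. B x _"] B')
  have "B (S g) (S g) = sweedler ?B (g * S g)"
    by (simp add: antipode_group_like_right sweedler_one[OF bil])
  also have "\<dots> = sweedler (\<lambda>a b. sweedler (\<lambda>c d. ?B (a * c) (b * d)) (S g)) g"
    by (rule sweedler_mult[OF bil])
  also have "\<dots> = sweedler (\<lambda>c d. ?B (g * c) (g * d)) (S g)"
    by (intro sweedler_group_like[OF comult] bilinear_formI linear_form_sweedler_parameter
        linear_form_mult_left[of "B _"] linear_form_mult_right[of "\<lambda>x. B _ (_ * x)"]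
        linear_form_mult_left[of "\<lambda>x. B x _"] linear_form_mult_right[of "\<lambda>x. B (_ * x) _"] B')
  finally show ?thesis
    by (simp add: cancel)
qed

lemma antipode_group_like_counit: "\<epsilon> (S g) = 1"
  using counit_mult[of g "S g"] by (simp add: antipode_group_like_right counit_one group_like_counit)

end

end


section \<open>Skew primitive elements are independent over a Hopf subalgebra\<close>

locale skew_primitive_family = hopf_algebra scale \<Delta> \<epsilon> S
  for scale :: "'k::field \<Rightarrow> 'h::ring_1 \<Rightarrow> 'h"
    and \<Delta> :: "'h \<Rightarrow> ('h \<times> 'h \<Rightarrow>\<^sub>0 'k)"
    and \<epsilon> :: "'h \<Rightarrow> 'k"
    and S :: "'h \<Rightarrow> 'h" +
  fixes D :: "'h set"
    and I :: "'i::linorder set"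
    and y g :: "'i \<Rightarrow> 'h"
  assumes hopf_subalgebra: "hopf_subalgebra scale \<Delta> S D"
    and finite_index: "finite I"
    and weight_in: "i \<in> I \<Longrightarrow> g i \<in> D"
    and weight_neq_0: "i \<in> I \<Longrightarrow> g i \<noteq> 0"
    and comult_weight: "i \<in> I \<Longrightarrow> tens_eq scale (\<Delta> (g i)) (tens (g i) (g i))"
    and comult_y: "i \<in> I \<Longrightarrow> tens_eq scale (\<Delta> (y i)) (tens (y i) 1 + tens (g i) (y i))"
    and independent_mod: "lin_indep_mod scale D I y"
begin

lemma subspace_D: "subspace D"
  and one_in_D: "1 \<in> D"
  and mult_in_D: "a \<in> D \<Longrightarrow> b \<in> D \<Longrightarrow> a * b \<in> D"
  and antipode_in_D: "a \<in> D \<Longrightarrow> S a \<in> D"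
  using hopf_subalgebra by (auto simp: hopf_subalgebra_def)

lemma weight_left_inverse: "i \<in> I \<Longrightarrow> S (g i) * g i = 1"
  and weight_right_inverse: "i \<in> I \<Longrightarrow> g i * S (g i) = 1"
  by (simp_all add: antipode_group_like_left antipode_group_like_right weight_neq_0 comult_weight)

lemma sweedler_y: "i \<in> I \<Longrightarrow> bilinear_form B \<Longrightarrow> sweedler B (y i) = B (y i) 1 + B (g i) (y i)"
  by (rule sweedler_skew_primitive[OF comult_y])

lemma sweedler_mult_y:
  assumes "i \<in> I" "bilinear_form B"
  shows "sweedler B (x * y i) = sweedler (\<lambda>a b. B (a * y i) b + B (a * g i) (b * y i)) x"
  by (simp add: sweedler_mult assms sweedler_y bilinear_form_translate_left)

text \<open>The elements \<open>g\<^sub>i\<^sup>-\<^sup>1 y\<^sub>i\<close>, with coproduct \<open>g\<^sub>i\<^sup>-\<^sup>1 y\<^sub>i \<otimes> g\<^sub>i\<^sup>-\<^sup>1 + 1 \<otimes> g\<^sub>i\<^sup>-\<^sup>1 y\<^sub>i\<close>. Having \<open>1\<close> as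
  left factor, the second summand behaves the same way for all \<open>i\<close>.\<close>

definition z :: "'i \<Rightarrow> 'h" where
  "z i = S (g i) * y i"

lemma y_eq: "i \<in> I \<Longrightarrow> y i = g i * z i"
  by (simp add: z_def weight_right_inverse flip: mult.assoc)

lemma sweedler_z:
  assumes i: "i \<in> I" and B: "bilinear_form B"
  shows "sweedler B (z i) = B (z i) (S (g i)) + B 1 (z i)"
proof -
  let ?h = "S (g i)"
  have "sweedler B (z i) = sweedler (\<lambda>a b. B (a * y i) b + B (a * g i) (b * y i)) ?h"
    unfolding z_def by (rule sweedler_mult_y[OF i B])
  also have "\<dots> = B (?h * y i) ?h + B (?h * g i) (?h * y i)"
    by (rule sweedler_antipode_group_like[OF weight_neq_0[OF i] comult_weight[OF i]])
      (use bilinear_form_translate_right[OF B, of "y i" 1]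
        bilinear_form_translate_right[OF B, of "g i" "y i"] in \<open>auto intro: bilinear_form_plus\<close>)
  finally show ?thesis
    by (simp add: z_def weight_left_inverse i)
qed

lemma sweedler_mult_z:
  assumes "i \<in> I" "bilinear_form B"
  shows "sweedler B (x * z i) = sweedler (\<lambda>a b. B (a * z i) (b * S (g i)) + B a (b * z i)) x"
  by (simp add: sweedler_mult assms sweedler_z bilinear_form_translate_left)

lemma sweedler_eq_0:
  assumes "x \<in> D" "bilinear_form B" "\<And>a b. a \<in> D \<Longrightarrow> b \<in> D \<Longrightarrow> B a b = 0"
  shows "sweedler B x = 0"
  using sweedler_cong_subcoalgebra[OF hopf_subalgebra assms(1,2), of "\<lambda>a b. 0"] assms(3)
  by (simp add: bilinear_formI linear_form_const_0 sweedler_form_0)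

text \<open>Modulo \<open>D\<close> in the left tensor factor, \<open>\<Delta> z\<^sub>i\<close> is \<open>z\<^sub>i \<otimes> g\<^sub>i\<^sup>-\<^sup>1\<close>. Applying a form \<open>u\<close> to the right
  factor thus rescales the coefficients of a relation by the values \<open>u(g\<^sub>i\<^sup>-\<^sup>1)\<close>. Distinct
  group-like elements are not proportional, so some \<open>u\<close> kills one weight but not another and
  yields a shorter relation; by induction only one weight occurs. A relation within one weight is
  a relation between the \<open>y\<^sub>i\<close>.\<close>

lemma z_independent_mod:
  assumes "J \<subseteq> I" "(\<Sum>i\<in>J. scale (c i) (z i)) \<in> D" "i \<in> J"
  shows "c i = 0"
proof -
  have "finite J"
    using assms(1) finite_index finite_subset by blast
  then show ?thesis
    using assms
  proof (induct "card J" arbitrary: J c i rule: less_induct)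
    case less
    note J = \<open>J \<subseteq> I\<close> and fin = \<open>finite J\<close>
    have rescaled: "(\<Sum>j\<in>J. scale (c j * u (S (g j))) (z j)) \<in> D" if u: "linear_form u" for u
    proof (rule in_subspaceI_linear_forms[OF subspace_D])
      fix f
      assume f: "linear_form f" and f0: "\<And>x. x \<in> D \<Longrightarrow> f x = 0"
      let ?B = "\<lambda>a b. f a * u b"
      have B: "bilinear_form ?B"
        by (rule bilinear_form_product[OF f u])
      have "0 = sweedler ?B (\<Sum>j\<in>J. scale (c j) (z j))"
        by (simp add: sweedler_eq_0[OF less.prems(3) B] f0)
      also have "\<dots> = (\<Sum>j\<in>J. c j * sweedler ?B (z j))"
        by (simp add: linear_form_sum[OF linear_form_sweedler[OF B]]
            linear_form_scale[OF linear_form_sweedler[OF B]])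
      also have "\<dots> = (\<Sum>j\<in>J. c j * (f (z j) * u (S (g j))))"
        by (intro sum.cong refl) (use J in \<open>auto simp: sweedler_z[OF _ B] f0 one_in_D\<close>)
      finally show "f (\<Sum>j\<in>J. scale (c j * u (S (g j))) (z j)) = 0"
        by (simp add: linear_form_sum[OF f] linear_form_scale[OF f] ac_simps)
    qed
    have other_weight: "c j = 0" if j: "j \<in> J" "g j \<noteq> g i" for j
    proof -
      have jI: "j \<in> I" and iI: "i \<in> I"
        using J j less.prems by auto
      have "S (g j) \<notin> span {S (g i)}"
      proof
        assume "S (g j) \<in> span {S (g i)}"
        then obtain k where k: "S (g j) = scale k (S (g i))"
          by (auto simp: span_singleton)
        have "k = 1"
          using arg_cong[OF k, of \<epsilon>] linear_form_scale[OF linear_form_counit]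
          by (simp add: antipode_group_like_counit weight_neq_0 comult_weight iI jI)
        then have "g j = g j * (S (g i) * g i)"
          using weight_left_inverse[OF iI] by simp
        also have "\<dots> = g i"
          using k \<open>k = 1\<close> weight_right_inverse[OF jI] by (simp flip: mult.assoc)
        finally show False
          using j by simp
      qed
      then obtain u where u: "linear_form u" "u (S (g i)) = 0" "u (S (g j)) = 1"
        by (metis separating_linear_form subspace_span span_base insertI1)
      have "(\<Sum>j\<in>J - {i}. scale (c j * u (S (g j))) (z j)) \<in> D"
        using rescaled[OF u(1)] fin \<open>i \<in> J\<close> by (simp add: sum.remove[of J i] u(2))
      moreover have "card (J - {i}) < card J"
        by (intro psubset_card_mono fin) (use \<open>i \<in> J\<close> in auto)
      ultimately have "c j * u (S (g j)) = 0"
        using less.hyps[of "J - {i}" "\<lambda>j. c j * u (S (g j))" j] fin J j by auto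
      then show ?thesis
        using u by simp
    qed
    define K where "K = {j \<in> J. g j = g i}"
    have K: "K \<subseteq> I" "finite K" "i \<in> K"
      using J fin less.prems by (auto simp: K_def)
    have "(\<Sum>j\<in>K. scale (c j) (y j)) = g i * (\<Sum>j\<in>J. scale (c j) (z j))"
    proof -
      have "(\<Sum>j\<in>K. scale (c j) (y j)) = (\<Sum>j\<in>K. g i * scale (c j) (z j))"
        by (intro sum.cong refl) (use J in \<open>auto simp: K_def y_eq scale_mult_right\<close>)
      also have "\<dots> = (\<Sum>j\<in>J. g i * scale (c j) (z j))"
        by (rule sum.mono_neutral_left) (use fin other_weight in \<open>auto simp: K_def\<close>)
      finally show ?thesis
        by (simp add: sum_distrib_left)
    qed
    also have "\<dots> \<in> D"
      using less.prems J by (intro mult_in_D weight_in) auto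
    finally show ?case
      using independent_mod K unfolding lin_indep_mod_def by blast
  qed
qed

text \<open>Let \<open>x = \<Sum> d\<^sub>i z\<^sub>i\<close> lie in \<open>D\<close>. Then \<open>\<Delta> x\<close> lies in \<open>D \<otimes> D\<close>, and modulo \<open>H \<otimes> D\<close> this leaves
  \<open>\<Sum> \<Delta>(d\<^sub>i) (1 \<otimes> z\<^sub>i) = 0\<close> in \<open>D \<otimes> H/D\<close>. The endomorphism \<open>a \<otimes> b \<mapsto> a\<^sub>1 \<otimes> S(a\<^sub>2) b\<close> of \<open>D \<otimes> H/D\<close>
  turns it into \<open>\<Sum> d\<^sub>i \<otimes> z\<^sub>i = 0\<close>. Here \<open>e\<close> and \<open>f\<close> evaluate the two tensor factors; in the proof,
  a projection \<open>p\<close> onto \<open>D\<close> extends the endomorphism to a bilinear form on all of \<open>H\<close>.\<close>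

lemma tensor_relation_z:
  assumes d: "\<And>i. i \<in> I \<Longrightarrow> d i \<in> D" and rel: "(\<Sum>i\<in>I. d i * z i) \<in> D"
    and e: "linear_form e" and f: "linear_form f" and f0: "\<And>x. x \<in> D \<Longrightarrow> f x = 0"
  shows "(\<Sum>i\<in>I. e (d i) * f (z i)) = 0"
proof -
  obtain p where p: "Vector_Spaces.linear scale scale p" "\<And>x. p x \<in> D" "\<And>u. u \<in> D \<Longrightarrow> p u = u"
    by (rule projection_onto_subspace[OF subspace_D]) blast
  define A where "A = (\<lambda>b a1 a2. e a1 * f (S a2 * b))"
  have A: "bilinear_form (A b)" for b
    unfolding A_def
    by (rule bilinear_form_product[OF e])
      (rule linear_form_antipode, rule linear_form_mult_right[OF f])
  have A': "linear_form (\<lambda>b. A b a1 a2)" for a1 a2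
    unfolding A_def by (intro linear_form_cmult linear_form_mult_left f)
  define B where "B = (\<lambda>a b. sweedler (A b) (p a))"
  have B: "bilinear_form B"
    unfolding B_def
    by (intro bilinear_formI linear_form_sweedler_parameter A'
        linear_form_compose[OF linear_form_sweedler[OF A] p(1)])
  have B0: "B a b = 0" if "b \<in> D" for a b
    unfolding B_def A_def
    by (rule sweedler_eq_0[OF p(2) A[unfolded A_def]])
      (simp add: f0 mult_in_D antipode_in_D that)
  have summand: "sweedler B (d i * z i) = e (d i) * f (z i)" if i: "i \<in> I" for i
  proof -
    have gS: "S (g i) \<in> D"
      by (intro antipode_in_D weight_in i)
    have bil: "bilinear_form (\<lambda>a b. sweedler (A (b * z i)) a)"
      by (intro bilinear_formI linear_form_sweedler_parameter
          linear_form_mult_right[OF A'] linear_form_sweedler A)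
    have "sweedler B (d i * z i) =
        sweedler (\<lambda>a b. B (a * z i) (b * S (g i)) + B a (b * z i)) (d i)"
      by (rule sweedler_mult_z[OF i B])
    also have "\<dots> = sweedler (\<lambda>a b. sweedler (A (b * z i)) a) (d i)"
    proof (rule sweedler_cong_subcoalgebra[OF hopf_subalgebra d[OF i] _ bil])
      show "bilinear_form (\<lambda>a b. B (a * z i) (b * S (g i)) + B a (b * z i))"
        using bilinear_form_translate_right[OF B, of "z i" "S (g i)"]
          bilinear_form_translate_right[OF B, of 1 "z i"]
        by (auto intro: bilinear_form_plus)
      show "B (a * z i) (b * S (g i)) + B a (b * z i) = sweedler (A (b * z i)) a"
        if "a \<in> D" "b \<in> D" for a b
        by (simp add: B0 mult_in_D gS that) (simp add: B_def p that)
    qed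
    also have "\<dots> = sweedler (\<lambda>a b. sweedler (\<lambda>b1 b2. A (b2 * z i) a b1) b) (d i)"
      by (rule sweedler_coassoc)
        (intro linear_form_mult_right[OF A'] bilinear_formD[OF A])+
    also have "\<dots> = sweedler (\<lambda>a b. f (z i) * (e a * \<epsilon> b)) (d i)"
    proof -
      have "sweedler (\<lambda>b1 b2. A (b2 * z i) a b1) b = f (z i) * (e a * \<epsilon> b)" for a b
        using sweedler_antipode_left[OF linear_form_mult_right[OF f], of "z i" b]
        by (simp add: A_def sweedler_form_cmult mult.assoc)
      then show ?thesis by simp
    qed
    also have "\<dots> = e (d i) * f (z i)"
      by (simp add: sweedler_form_cmult sweedler_counit_right[OF e])
    finally show ?thesis .
  qed
  have "0 = sweedler B (\<Sum>i\<in>I. d i * z i)"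
    by (simp add: sweedler_eq_0[OF rel B] B0)
  also have "\<dots> = (\<Sum>i\<in>I. e (d i) * f (z i))"
    by (simp add: linear_form_sum[OF linear_form_sweedler[OF B]] summand)
  finally show ?thesis by simp
qed

text \<open>The case of degree one: \<open>y\<^sub>i = g\<^sub>i z\<^sub>i\<close>, and \<open>\<Sum> d\<^sub>i g\<^sub>i \<otimes> z\<^sub>i = 0\<close> in \<open>D \<otimes> H/D\<close> forces
  \<open>d\<^sub>i g\<^sub>i = 0\<close> because the \<open>z\<^sub>i\<close> are independent modulo \<open>D\<close>.\<close>

lemma skew_primitives_independent_over:
  assumes d: "\<And>i. i \<in> I \<Longrightarrow> d i \<in> D" and rel: "(\<Sum>i\<in>I. d i * y i) \<in> D" and i: "i \<in> I"
  shows "d i = 0"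
proof -
  have rel': "(\<Sum>i\<in>I. (d i * g i) * z i) \<in> D"
    using rel by (simp add: y_eq mult.assoc)
  have "d i * g i = 0"
  proof (rule eq_0I_linear_forms)
    fix e
    assume e: "linear_form e"
    have "(\<Sum>i\<in>I. scale (e (d i * g i)) (z i)) \<in> D"
    proof (rule in_subspaceI_linear_forms[OF subspace_D])
      fix f
      assume f: "linear_form f" and f0: "\<And>u. u \<in> D \<Longrightarrow> f u = 0"
      show "f (\<Sum>i\<in>I. scale (e (d i * g i)) (z i)) = 0"
        using tensor_relation_z[OF mult_in_D[OF d weight_in] rel' e f f0]
        by (simp add: linear_form_sum[OF f] linear_form_scale[OF f])
    qed
    then show "e (d i * g i) = 0"
      using z_independent_mod[of I "\<lambda>i. e (d i * g i)" i] i by simp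
  qed
  then have "d i * g i * S (g i) = 0" by simp
  then show ?thesis
    by (simp add: weight_right_inverse i mult.assoc)
qed

end


section \<open>Ordered monomials are independent over a Hopf subalgebra\<close>

context k_algebra
begin

definition independent_over :: "'h set \<Rightarrow> ('u \<Rightarrow> 'h) \<Rightarrow> 'u set \<Rightarrow> bool" where
  "independent_over D F A \<longleftrightarrow>
     (\<forall>d. (\<forall>u\<in>A. d u \<in> D) \<longrightarrow> (\<Sum>u\<in>A. d u * F u) = 0 \<longrightarrow> (\<forall>u\<in>A. d u = 0))"

lemma products_of_independent:
  assumes D: "subspace D" and A: "finite A" and F: "independent_over D F A"
    and B: "B \<subseteq> D" "independent B"
  shows "inj_on (\<lambda>(b, u). b * F u) (B \<times> A)" "independent ((\<lambda>(b, u). b * F u) ` (B \<times> A))"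
proof -
  have "\<forall>t\<in>T. c t = 0"
    if T: "finite T" "T \<subseteq> B \<times> A"
      and rel: "(\<Sum>t\<in>T. scale (c t) (case t of (b, u) \<Rightarrow> b * F u)) = 0" for T c
  proof -
    define R where "R = fst ` T"
    have R: "finite R" "R \<subseteq> B" "T \<subseteq> R \<times> A"
      using T by (auto simp: R_def intro: rev_image_eqI)
    \<comment> \<open>Extending \<open>c\<close> by zero to a rectangle allows the relation to be sorted by \<open>u\<close>.\<close>
    define c' where "c' t = (if t \<in> T then c t else 0)" for t
    have "(\<Sum>u\<in>A. (\<Sum>b\<in>R. scale (c' (b, u)) b) * F u) =
        (\<Sum>b\<in>R. \<Sum>u\<in>A. scale (c' (b, u)) (b * F u))"
      by (subst sum.swap) (simp add: sum_distrib_right scale_mult_left)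
    also have "\<dots> = (\<Sum>t\<in>R \<times> A. scale (c' t) (case t of (b, u) \<Rightarrow> b * F u))"
      by (simp add: sum.cartesian_product case_prod_beta')
    also have "\<dots> = (\<Sum>t\<in>T. scale (c t) (case t of (b, u) \<Rightarrow> b * F u))"
      by (rule sum.mono_neutral_cong_right) (use R A in \<open>auto simp: c'_def\<close>)
    finally have "(\<Sum>u\<in>A. (\<Sum>b\<in>R. scale (c' (b, u)) b) * F u) = 0"
      using rel by simp
    moreover have "(\<Sum>b\<in>R. scale (c' (b, u)) b) \<in> D" for u
      using R B by (intro subspace_sum[OF D] subspace_scale[OF D]) auto
    ultimately have "\<forall>u\<in>A. (\<Sum>b\<in>R. scale (c' (b, u)) b) = 0"
      using F[unfolded independent_over_def, rule_format,
          of "\<lambda>u. \<Sum>b\<in>R. scale (c' (b, u)) b"] by blast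
    then have zero: "\<forall>u\<in>A. (\<Sum>b\<in>R. scale (c' (b, u)) b) = 0" .
    have "c' (b, u) = 0" if "u \<in> A" "b \<in> R" for b u
      using independentD[OF B(2) R(1,2), of "\<lambda>b. c' (b, u)" b] that zero by blast
    then show ?thesis
      using R by (force simp: c'_def split: if_splits)
  qed
  then show "inj_on (\<lambda>(b, u). b * F u) (B \<times> A)"
      "independent ((\<lambda>(b, u). b * F u) ` (B \<times> A))"
    by (rule independent_familyI; blast)+
qed

lemma linear_form_on_products:
  assumes D: "subspace D" and A: "finite A" and F: "independent_over D F A"
    and h: "\<And>u. u \<in> A \<Longrightarrow> linear_form (h u)"
  obtains f where "linear_form f" "\<And>d u. d \<in> D \<Longrightarrow> u \<in> A \<Longrightarrow> f (d * F u) = h u d"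
proof -
  obtain B where B: "B \<subseteq> D" "independent B" "D \<subseteq> span B"
    by (rule maximal_independent_subset[of D])
  let ?P = "\<lambda>(b, u). b * F u"
  note P = products_of_independent[OF D A F B(1,2)]
  define k where "k x = (case inv_into (B \<times> A) ?P x of (b, u) \<Rightarrow> h u b)" for x
  obtain f where f: "linear_form f" "\<And>x. x \<in> ?P ` (B \<times> A) \<Longrightarrow> f x = k x"
    using linear_form_on_independent[OF P(2)] by blast
  have basis: "f (b * F u) = h u b" if "b \<in> B" "u \<in> A" for b u
  proof -
    have "f (?P (b, u)) = k (?P (b, u))"
      by (rule f(2)) (use that in blast)
    then show ?thesis
      using inv_into_f_f[OF P(1), of "(b, u)"] that by (simp add: k_def)
  qed
  have "f (d * F u) = h u d" if "d \<in> D" "u \<in> A" for d u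
  proof (rule linear_form_eq_on_span[OF _ h[OF that(2)]])
    show "linear_form (\<lambda>d. f (d * F u))"
      using f(1) by (simp add: linear_form_def distrib_right scale_mult_left)
    show "f (b * F u) = h u b" if "b \<in> B" for b
      using basis that \<open>u \<in> A\<close> .
    show "d \<in> span B"
      using that B by auto
  qed
  then show ?thesis
    using that f(1) by blast
qed

end

locale skew_commuting_family = skew_primitive_family scale \<Delta> \<epsilon> S D I y g
  for scale :: "'k::field \<Rightarrow> 'h::ring_1 \<Rightarrow> 'h"
    and \<Delta> :: "'h \<Rightarrow> ('h \<times> 'h \<Rightarrow>\<^sub>0 'k)"
    and \<epsilon> :: "'h \<Rightarrow> 'k"
    and S :: "'h \<Rightarrow> 'h"
    and D :: "'h set"
    and I :: "'i::linorder set"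
    and y g :: "'i \<Rightarrow> 'h" +
  fixes lam :: "'i \<Rightarrow> 'i \<Rightarrow> 'k"
  assumes skew_commute: "i \<in> I \<Longrightarrow> j \<in> I \<Longrightarrow> i \<le> j \<Longrightarrow> y i * g j = scale (lam i j) (g j * y i)"
    and lam_neq_0: "i \<in> I \<Longrightarrow> j \<in> I \<Longrightarrow> i \<le> j \<Longrightarrow> lam i j \<noteq> 0"
    and q_number_neq_0: "i \<in> I \<Longrightarrow> (\<Sum>k\<le>n. lam i i ^ k) \<noteq> 0"
begin

abbreviation Y :: "'i list \<Rightarrow> 'h" where
  "Y v \<equiv> prod_list (map y v)"

abbreviation G :: "'i list \<Rightarrow> 'h" where
  "G v \<equiv> prod_list (map g v)"

definition words :: "nat \<Rightarrow> 'i list set" where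
  "words n = {v. sorted v \<and> set v \<subseteq> I \<and> length v \<le> n}"

lemma finite_words: "finite (words n)"
  unfolding words_def
  by (rule finite_subset[OF _ finite_lists_length_le[OF finite_index, of n]]) auto

text \<open>Expanding the product of the factors \<open>y\<^sub>i \<otimes> 1 + g\<^sub>i \<otimes> y\<^sub>i\<close> over the letters \<open>i\<close> of \<open>v\<close>
  gives \<open>\<Delta> (Y v)\<close> as the sum of \<open>a \<otimes> Y u\<close> over the entries \<open>(a, u)\<close> of the following list.\<close>

primrec comult_terms :: "'i list \<Rightarrow> ('h \<times> 'i list) list" where
  "comult_terms [] = [(1, [])]"
| "comult_terms (i # v) =
     map (\<lambda>(a, u). (y i * a, u)) (comult_terms v) @
     map (\<lambda>(a, u). (g i * a, i # u)) (comult_terms v)"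

lemma sweedler_Y:
  assumes "set v \<subseteq> I" "bilinear_form B"
  shows "sweedler B (Y v) = (\<Sum>(a, u)\<leftarrow>comult_terms v. B a (Y u))"
  using assms
proof (induct v arbitrary: B)
  case Nil
  then show ?case
    by (simp add: sweedler_one)
next
  case (Cons i v)
  have i: "i \<in> I" and v: "set v \<subseteq> I"
    using Cons.prems by auto
  note B = \<open>bilinear_form B\<close>
  have "sweedler B (Y (i # v)) = sweedler (\<lambda>a b. sweedler (\<lambda>c d. B (a * c) (b * d)) (Y v)) (y i)"
    by (simp add: sweedler_mult[OF B])
  also have "\<dots> = sweedler (\<lambda>c d. B (y i * c) (1 * d)) (Y v) +
      sweedler (\<lambda>c d. B (g i * c) (y i * d)) (Y v)"
    by (rule sweedler_y[OF i])
      (intro bilinear_formI linear_form_sweedler_parameter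
        bilinear_formD[OF bilinear_form_translate_right[OF B, of 1]]
        linear_form_mult_right[OF bilinear_formD(1)[OF B]]
        linear_form_mult_right[OF bilinear_formD(2)[OF B]])
  also have "sweedler (\<lambda>c d. B (y i * c) (1 * d)) (Y v) =
      (\<Sum>(a, u)\<leftarrow>comult_terms v. B (y i * a) (1 * Y u))"
    by (rule Cons.hyps[OF v bilinear_form_translate_left[OF B]])
  also have "sweedler (\<lambda>c d. B (g i * c) (y i * d)) (Y v) =
      (\<Sum>(a, u)\<leftarrow>comult_terms v. B (g i * a) (y i * Y u))"
    by (rule Cons.hyps[OF v bilinear_form_translate_left[OF B]])
  finally show ?case
    by (simp add: comp_def case_prod_beta')
qed

lemma comult_terms_cases:
  "(a, u) \<in> set (comult_terms v) \<Longrightarrow>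
    u = v \<and> a = G v \<or> length u < length v \<and> set u \<subseteq> set v \<and> (sorted v \<longrightarrow> sorted u)"
  by (induct v arbitrary: a u) (auto, fastforce+)

text \<open>The left tensor factor at \<open>Y m\<close> in the expansion of \<open>\<Delta> (Y v)\<close>. In degree
  \<open>length m = length v - 1\<close> it is nonzero only if \<open>v\<close> arises from \<open>m\<close> by inserting one letter
  \<open>i\<close>, and then it is a nonzero multiple of \<open>G m * y i\<close>.\<close>

definition coefficient :: "'i list \<Rightarrow> 'i list \<Rightarrow> 'h" where
  "coefficient v m = (\<Sum>(a, u)\<leftarrow>comult_terms v. if u = m then a else 0)"

lemma coefficient_Nil: "coefficient [] m = (if m = [] then 1 else 0)"
  by (simp add: coefficient_def)

lemma coefficient_Cons:
  "coefficient (i # v) m = y i * coefficient v m +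
    (case m of [] \<Rightarrow> 0 | j # m' \<Rightarrow> if i = j then g i * coefficient v m' else 0)"
proof -
  have "(\<Sum>(a, u)\<leftarrow>ts. if u = m then x * a else 0) =
      x * (\<Sum>(a, u)\<leftarrow>ts. if u = m then a else 0)" for x m and ts :: "('h \<times> 'i list) list"
    by (induct ts) (auto simp: distrib_left)
  moreover have "(\<Sum>(a, u)\<leftarrow>ts. if i # u = m then g i * a else 0) =
      (case m of [] \<Rightarrow> 0 | j # m' \<Rightarrow>
        if i = j then \<Sum>(a, u)\<leftarrow>ts. if u = m' then g i * a else 0 else 0)"
    for ts :: "('h \<times> 'i list) list"
    by (induct ts) (auto split: list.splits)
  ultimately show ?thesis
    by (auto simp: coefficient_def comp_def case_prod_beta' cong: if_cong split: list.splits)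
qed

lemma coefficient_longer: "length v < length m \<Longrightarrow> coefficient v m = 0"
  by (induct v arbitrary: m) (auto simp: coefficient_Nil coefficient_Cons split: list.splits)

lemma coefficient_same_length:
  "length v = length m \<Longrightarrow> coefficient v m = (if v = m then G m else 0)"
  by (induct v arbitrary: m)
    (auto simp: coefficient_Nil coefficient_Cons coefficient_longer split: list.splits)

lemma coefficient_not_insert:
  assumes "sorted v" "sorted m" "length v = Suc (length m)" "coefficient v m \<noteq> 0"
  shows "\<exists>i\<in>set v. v = insort i m"
  using assms
proof (induct v arbitrary: m)
  case (Cons j v)
  show ?case
  proof (cases "v = m")
    case True
    then show ?thesis
      using Cons.prems by (auto intro!: bexI[of _ j] simp: insort_is_Cons)
  next
    case False
    then have "coefficient v m = 0"
      using Cons.prems by (simp add: coefficient_same_length)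
    then obtain m' where m: "m = j # m'" "g j * coefficient v m' \<noteq> 0"
      using Cons.prems by (auto simp: coefficient_Cons split: list.splits if_splits)
    then have "coefficient v m' \<noteq> 0"
      by auto
    then obtain i where i: "i \<in> set v" "v = insort i m'"
      using Cons m by auto
    then have "j \<le> i"
      using Cons.prems by auto
    then have "j # v = insort i m"
      using i m Cons.prems by (auto simp: insort_is_Cons)
    then show ?thesis
      using i(1) by (intro bexI[of _ i]) (auto simp: set_insort_key)
  qed
qed simp

text \<open>The multiple in question, for the insertion of \<open>i\<close> into \<open>m\<close>: moving \<open>y\<^sub>i\<close> to the right past \<open>g\<^sub>j\<close> costs
  \<open>\<lambda>\<^sub>i\<^sub>j\<close>, and the \<open>n + 1\<close> ways of removing one letter \<open>i\<close> from a block of \<open>n + 1\<close> equal letters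
  add up to the \<open>q\<close>-number \<open>1 + q + \<dots> + q\<^sup>n\<close> for \<open>q = \<lambda>\<^sub>i\<^sub>i\<close>.\<close>

definition removal_factor :: "'i \<Rightarrow> 'i list \<Rightarrow> 'k" where
  "removal_factor i m =
     (\<Prod>j\<leftarrow>filter (\<lambda>j. i < j) m. lam i j) * (\<Sum>k\<le>count_list m i. lam i i ^ k)"

lemma removal_factor_neq_0:
  assumes "i \<in> I" "set m \<subseteq> I"
  shows "removal_factor i m \<noteq> 0"
proof -
  have "(\<Prod>j\<leftarrow>filter (\<lambda>j. i < j) m. lam i j) \<noteq> 0"
    using assms lam_neq_0[OF assms(1)] by (force simp: prod_list_zero_iff)
  then show ?thesis
    using q_number_neq_0[OF assms(1)] by (simp add: removal_factor_def)
qed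

lemma y_mult_G:
  assumes "i \<in> I" "set m \<subseteq> I" "\<forall>j\<in>set m. i \<le> j"
  shows "y i * G m =
    scale ((\<Prod>j\<leftarrow>filter (\<lambda>j. i < j) m. lam i j) * lam i i ^ count_list m i) (G m * y i)"
  using assms(2,3)
proof (induct m)
  case (Cons j m)
  have "y i * G (j # m) = (y i * g j) * G m"
    by (simp add: mult.assoc)
  also have "\<dots> = scale (lam i j) (g j * (y i * G m))"
    using Cons.prems assms(1) by (simp add: skew_commute scale_mult_left mult.assoc)
  also have "\<dots> = scale (lam i j * ((\<Prod>j\<leftarrow>filter (\<lambda>j. i < j) m. lam i j) * lam i i ^ count_list m i))
      (G (j # m) * y i)"
    using Cons by (simp add: scale_mult_right mult.assoc)
  finally show ?case
    using Cons.prems by (cases "i = j") (auto simp: ac_simps)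
qed simp

lemma coefficient_insert:
  assumes "i \<in> I" "set m \<subseteq> I" "sorted m"
  shows "coefficient (insort i m) m = scale (removal_factor i m) (G m * y i)"
  using assms(2,3)
proof (induct m)
  case Nil
  then show ?case
    by (simp add: coefficient_Nil coefficient_Cons removal_factor_def)
next
  case (Cons j m)
  have IH: "coefficient (insort i m) m = scale (removal_factor i m) (G m * y i)"
    using Cons by simp
  consider "i < j" | "i = j" | "j < i"
    by fastforce
  then show ?case
  proof cases
    case 1
    have "i \<notin> set m" "filter (\<lambda>j. i < j) m = m"
      using 1 Cons.prems by (auto intro!: filter_True)
    then have "removal_factor i (j # m) =
        (\<Prod>j\<leftarrow>filter (\<lambda>j. i < j) (j # m). lam i j) * lam i i ^ count_list (j # m) i"
      using 1 by (simp add: removal_factor_def count_list_0_iff)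
    moreover have "coefficient (insort i (j # m)) (j # m) = y i * G (j # m)"
      using 1 by (simp add: coefficient_Cons[of i] coefficient_same_length less_imp_le)
    moreover have "\<forall>k\<in>set (j # m). i \<le> k"
      using 1 Cons.prems by auto
    ultimately show ?thesis
      using y_mult_G[OF assms(1) Cons.prems(1)] by simp
  next
    case 2
    have ins: "insort i m = i # m"
      using 2 Cons.prems by (simp add: insort_is_Cons)
    have "coefficient (insort i (j # m)) (j # m) =
        y i * G (j # m) + g i * coefficient (insort i m) m"
      using 2 ins by (simp add: coefficient_Cons[of j "j # m"] coefficient_same_length)
    also have "g i * coefficient (insort i m) m = scale (removal_factor i m) (G (j # m) * y i)"
      unfolding IH using 2 by (simp add: scale_mult_right mult.assoc)
    also have "y i * G (j # m) = scale ((\<Prod>j\<leftarrow>filter (\<lambda>j. i < j) m. lam i j) *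
        lam i i ^ Suc (count_list m i)) (G (j # m) * y i)"
      using y_mult_G[OF assms(1) Cons.prems(1)] 2 Cons.prems by simp
    finally show ?thesis
      using 2 by (simp add: removal_factor_def scale_left_distrib[symmetric]
          distrib_left[symmetric] add.commute)
  next
    case 3
    have "insort i m \<noteq> j # m"
    proof
      assume "insort i m = j # m"
      then have "mset (insort i m) = mset (j # m)" by simp
      then show False
        using 3 by simp
    qed
    then have "coefficient (insort i (j # m)) (j # m) = g j * coefficient (insort i m) m"
      using 3 by (simp add: coefficient_Cons[of j] coefficient_same_length flip: not_less)
    moreover have "removal_factor i (j # m) = removal_factor i m"
      using 3 by (auto simp: removal_factor_def)
    ultimately show ?thesis
      by (simp add: IH scale_mult_right mult.assoc)
  qed
qed

lemma G_in_D: "set v \<subseteq> I \<Longrightarrow> G v \<in> D"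
  by (induct v) (simp_all add: one_in_D mult_in_D weight_in)

lemma mult_G_eq_0:
  assumes "set v \<subseteq> I" "x * G v = 0"
  shows "x = 0"
  using assms
proof (induct v arbitrary: x)
  case (Cons i v)
  have "x * g i = 0"
    using Cons by (simp add: mult.assoc)
  then have "x * g i * S (g i) = 0" by simp
  then show ?case
    using Cons.prems by (simp add: mult.assoc weight_right_inverse)
qed simp

text \<open>With a form \<open>\<phi>\<close> that reads off \<open>\<epsilon>\<close> of the coefficient of \<open>Y m\<close> in degree at most \<open>n\<close>,
  contracting the right factor of \<open>\<Delta>(d * Y v)\<close> by \<open>\<phi>\<close> gives, modulo \<open>D\<close>, \<open>d\<close> times the
  coefficient of \<open>Y m\<close>. In degree \<open>n + 1\<close>, where \<open>\<phi>\<close> is unknown, the only monomial is \<open>Y v\<close>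
  itself, and its left factor lies in \<open>D\<close>, where \<open>f\<close> vanishes.\<close>

lemma sweedler_contraction:
  assumes v: "v \<in> words (Suc n)" and d: "d \<in> D" and m: "length m = n"
    and f: "linear_form f" and f0: "\<And>x. x \<in> D \<Longrightarrow> f x = 0"
    and phi: "linear_form \<phi>"
      "\<And>d u. d \<in> D \<Longrightarrow> u \<in> words n \<Longrightarrow> \<phi> (d * Y u) = (if u = m then \<epsilon> d else 0)"
  shows "sweedler (\<lambda>a b. f a * \<phi> b) (d * Y v) = f (d * coefficient v m)"
proof -
  let ?B = "\<lambda>a b. f a * \<phi> b"
  have B: "bilinear_form ?B"
    by (rule bilinear_form_product[OF f phi(1)])
  have vI: "set v \<subseteq> I"
    using v by (simp add: words_def)
  have "sweedler ?B (d * Y v) =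
      sweedler (\<lambda>p q. sweedler (\<lambda>c d. ?B (p * c) (q * d)) (Y v)) d"
    by (rule sweedler_mult[OF B])
  also have "\<dots> = sweedler (\<lambda>p q. \<Sum>t\<leftarrow>comult_terms v. ?B (p * fst t) (q * Y (snd t))) d"
    by (simp add: sweedler_Y[OF vI bilinear_form_translate_left[OF B]] case_prod_beta')
  also have "\<dots> =
      (\<Sum>t\<leftarrow>comult_terms v. sweedler (\<lambda>p q. ?B (p * fst t) (q * Y (snd t))) d)"
    by (rule sweedler_form_sum_list)
  also have "\<dots> = (\<Sum>t\<leftarrow>comult_terms v. f (d * (if snd t = m then fst t else 0)))"
  proof (intro arg_cong[where f = sum_list] map_cong refl)
    fix t
    assume t: "t \<in> set (comult_terms v)"
    obtain a u where au: "t = (a, u)"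
      by (cases t)
    have bil: "bilinear_form (\<lambda>p q. ?B (p * a) (q * Y u))"
      by (rule bilinear_form_translate_right[OF B])
    have "sweedler (\<lambda>p q. ?B (p * a) (q * Y u)) d = f (d * (if u = m then a else 0))"
    proof (cases "u \<in> words n")
      case True
      have fa: "linear_form (\<lambda>p. f (p * a))"
        by (rule linear_form_mult_right[OF f])
      have "sweedler (\<lambda>p q. ?B (p * a) (q * Y u)) d =
          sweedler (\<lambda>p q. (if u = m then 1 else 0) * (f (p * a) * \<epsilon> q)) d"
        by (rule sweedler_cong_subcoalgebra[OF hopf_subalgebra d bil])
          (auto intro!: bilinear_form_product[OF fa linear_form_counit] bilinear_formI
            simp: phi(2)[OF _ True])
      also have "\<dots> = f (d * (if u = m then a else 0))"
        by (subst sweedler_form_cmult) (simp add: sweedler_counit_right[OF fa] linear_form_0[OF f])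
      finally show ?thesis .
    next
      case False
      have "u = v" "a = G v" "length v = Suc n"
        using comult_terms_cases[OF t[unfolded au]] False v by (auto simp: words_def)
      then have "a \<in> D" "u \<noteq> m"
        using G_in_D[OF vI] m by auto
      then show ?thesis
        using sweedler_eq_0[OF d bil] by (simp add: f0 mult_in_D linear_form_0[OF f])
    qed
    then show "sweedler (\<lambda>p q. ?B (p * fst t) (q * Y (snd t))) d =
        f (d * (if snd t = m then fst t else 0))"
      by (simp add: au)
  qed
  also have "\<dots> = f (d * (\<Sum>t\<leftarrow>comult_terms v. if snd t = m then fst t else 0))"
    by (induct ("comult_terms v"))
      (simp_all add: distrib_left linear_form_0[OF f] linear_form_add[OF f])
  finally show ?thesis
    by (simp add: coefficient_def case_prod_beta')
qed

text \<open>Induction on the length: in a relation between words of length at most \<open>n + 1\<close>,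
  contraction with the form reading off \<open>Y m\<close>, for a word \<open>m\<close> of length \<open>n\<close>, leaves a relation
  modulo \<open>D\<close> between the \<open>y\<^sub>i\<close>, in which \<open>y\<^sub>i\<close> has the coefficient of \<open>Y (insort i m)\<close> up to an
  invertible factor.\<close>

theorem words_independent_over: "independent_over D Y (words n)"
proof (induct n)
  case 0
  have "words 0 = {[]}"
    by (auto simp: words_def)
  then show ?case
    by (simp add: independent_over_def)
next
  case (Suc n)
  show ?case
    unfolding independent_over_def
  proof (rule allI, rule impI, rule impI)
    fix d
    assume dD: "\<forall>u\<in>words (Suc n). d u \<in> D" and rel: "(\<Sum>u\<in>words (Suc n). d u * Y u) = 0"
    have longest: "d v = 0" if v: "v \<in> words (Suc n)" "length v = Suc n" for v
    proof -
      obtain i m where vim: "v = i # m"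
        using v(2) by (cases v) auto
      have i: "i \<in> I" and m: "sorted m" "set m \<subseteq> I" "length m = n"
        using v vim by (auto simp: words_def)
      have v_insort: "v = insort i m"
        using v vim by (simp add: words_def insort_is_Cons)
      have ins: "insort j m \<in> words (Suc n)" if "j \<in> I" for j
        using m that by (auto simp: words_def sorted_insort set_insort_key)
      have linear_h: "linear_form (\<lambda>d. if u = m then \<epsilon> d else 0)" for u
        by (cases "u = m") (simp_all add: linear_form_counit linear_form_const_0)
      obtain \<phi> where phi: "linear_form \<phi>"
          "\<And>d u. d \<in> D \<Longrightarrow> u \<in> words n \<Longrightarrow> \<phi> (d * Y u) = (if u = m then \<epsilon> d else 0)"
        by (rule linear_form_on_products[OF subspace_D finite_words Suc,
              where h = "\<lambda>u d. if u = m then \<epsilon> d else 0"], rule linear_h) blast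
      define e where "e j = scale (removal_factor j m) (d (insort j m) * G m)" for j
      have e_in: "e j \<in> D" if "j \<in> I" for j
        unfolding e_def using dD ins[OF that] m
        by (intro subspace_scale[OF subspace_D] mult_in_D G_in_D) auto
      have "(\<Sum>j\<in>I. e j * y j) \<in> D"
      proof (rule in_subspaceI_linear_forms[OF subspace_D])
        fix f
        assume f: "linear_form f" and f0: "\<And>x. x \<in> D \<Longrightarrow> f x = 0"
        have B: "bilinear_form (\<lambda>a b. f a * \<phi> b)"
          by (rule bilinear_form_product[OF f phi(1)])
        have inj: "inj_on (\<lambda>j. insort j m) I"
          by (rule inj_onI) (drule arg_cong[where f = mset], simp)
        have zero: "f (d u * coefficient u m) = 0"
          if u: "u \<in> words (Suc n)" "u \<notin> (\<lambda>j. insort j m) ` I" for u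
        proof (cases "length u = Suc n")
          case True
          then have "coefficient u m = 0"
            using coefficient_not_insert[of u m] u m by (auto simp: words_def)
          then show ?thesis
            by (simp add: linear_form_0[OF f])
        next
          case False
          then have "length u \<le> length m"
            using u m by (auto simp: words_def)
          then have "coefficient u m \<in> D"
            using coefficient_longer[of u m] coefficient_same_length[of u m] G_in_D[OF m(2)]
              subspace_0[OF subspace_D] by (cases "length u = length m") auto
          then show ?thesis
            using dD u by (intro f0 mult_in_D) auto
        qed
        have "0 = sweedler (\<lambda>a b. f a * \<phi> b) (\<Sum>u\<in>words (Suc n). d u * Y u)"
          by (simp add: rel linear_form_0[OF linear_form_sweedler[OF B]])
        also have "\<dots> = (\<Sum>u\<in>words (Suc n). f (d u * coefficient u m))"
          unfolding linear_form_sum[OF linear_form_sweedler[OF B]]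
          by (intro sum.cong refl sweedler_contraction[OF _ _ m(3) f f0 phi]) (use dD in auto)
        also have "\<dots> = (\<Sum>u\<in>(\<lambda>j. insort j m) ` I. f (d u * coefficient u m))"
          by (rule sum.mono_neutral_right[OF finite_words]) (use ins zero in auto)
        also have "\<dots> = (\<Sum>j\<in>I. f (d (insort j m) * coefficient (insort j m) m))"
          by (simp add: sum.reindex[OF inj])
        also have "\<dots> = f (\<Sum>j\<in>I. e j * y j)"
          unfolding linear_form_sum[OF f] e_def
          by (intro sum.cong refl)
            (simp add: coefficient_insert m scale_mult_left scale_mult_right mult.assoc)
        finally show "f (\<Sum>j\<in>I. e j * y j) = 0" by simp
      qed
      then have "e i = 0"
        using skew_primitives_independent_over[of e i] e_in i by blast
      then have "d v * G m = 0"
        using removal_factor_neq_0[OF i m(2)] by (simp add: e_def v_insort)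
      then show "d v = 0"
        using mult_G_eq_0 m by blast
    qed
    have sub: "words n \<subseteq> words (Suc n)"
      by (auto simp: words_def)
    have "(\<Sum>u\<in>words n. d u * Y u) = (\<Sum>u\<in>words (Suc n). d u * Y u)"
    proof (rule sum.mono_neutral_left[OF finite_words sub], rule ballI)
      fix u
      assume "u \<in> words (Suc n) - words n"
      then show "d u * Y u = 0"
        using longest[of u] by (auto simp: words_def le_Suc_eq)
    qed
    then have "\<forall>u\<in>words n. d u = 0"
      using Suc dD sub rel unfolding independent_over_def by auto
    then show "\<forall>u\<in>words (Suc n). d u = 0"
      using longest by (auto simp: words_def le_Suc_eq)
  qed
qed

end


section \<open>Growth\<close>

context k_algebra
begin

lemma mult_in_span_products:
  assumes "x \<in> span A" "z \<in> span C"
  shows "x * z \<in> span {a * c | a c. a \<in> A \<and> c \<in> C}"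
  using assms(1)
proof (induct rule: span_induct_alt)
  case (step k a x)
  have "a * z \<in> span {a * c | a c. a \<in> A \<and> c \<in> C}"
    using assms(2)
  proof (induct rule: span_induct_alt)
    case (step l c z)
    then show ?case
      using \<open>a \<in> A\<close>
      by (auto simp: distrib_left scale_mult_right intro!: span_add span_scale intro: span_base)
  qed (simp add: span_zero)
  then show ?case
    using step by (auto simp: distrib_right scale_mult_left intro!: span_add span_scale)
qed (simp add: span_zero)

lemma prod_list_in_span:
  "set vs \<subseteq> span B \<Longrightarrow>
    prod_list vs \<in> span {prod_list us | us. set us \<subseteq> B \<and> length us = length vs}"
proof (induct vs)
  case Nil
  then show ?case
    by (auto intro: span_base)
next
  case (Cons v vs)
  let ?P = "\<lambda>l. {prod_list us | us. set us \<subseteq> B \<and> length us = l}"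
  have prod: "v * prod_list vs \<in> span {a * c | a c. a \<in> B \<and> c \<in> ?P (length vs)}"
    using Cons by (intro mult_in_span_products) auto
  have "{a * c | a c. a \<in> B \<and> c \<in> ?P (length vs)} \<subseteq> ?P (length (v # vs))"
  proof clarify
    fix a us
    assume "a \<in> B" "set us \<subseteq> B" "length us = length vs"
    then show "\<exists>us'. a * prod_list us = prod_list us' \<and> set us' \<subseteq> B \<and>
        length us' = length (v # vs)"
      by (intro exI[of _ "a # us"]) simp
  qed
  from subsetD[OF span_mono[OF this] prod] show ?case
    by simp
qed

definition products :: "'h set \<Rightarrow> nat \<Rightarrow> 'h set" where
  "products V n = {prod_list vs | vs. set vs \<subseteq> V \<and> length vs \<le> n}"

lemma gk_growth_eq: "gk_growth scale V n = dim (products V n)"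
  by (simp add: gk_growth_def products_def)

lemma products_subset_span:
  assumes "finite B"
  obtains P where "finite P" "products (span B) n \<subseteq> span P"
proof
  let ?P = "prod_list ` {us. set us \<subseteq> B \<and> length us \<le> n}"
  show "finite ?P"
    by (intro finite_imageI finite_lists_length_le assms)
  show "products (span B) n \<subseteq> span ?P"
  proof
    fix x
    assume "x \<in> products (span B) n"
    then obtain vs where vs: "x = prod_list vs" "set vs \<subseteq> span B" "length vs \<le> n"
      by (auto simp: products_def)
    have "{prod_list us | us. set us \<subseteq> B \<and> length us = length vs} \<subseteq> ?P"
      using vs by auto
    from span_mono[OF this] show "x \<in> span ?P"
      using prod_list_in_span[OF vs(2)] vs(1) by auto
  qed
qed

text \<open>The generators of \<open>V\<close> already span all products, so these spans are finite-dimensional and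
  \<open>dim\<close> is not its default value \<open>0\<close> for infinite-dimensional spaces.\<close>

lemma card_le_gk_growth:
  assumes "finite B" "independent C" "C \<subseteq> products (span B) n"
  shows "finite C" "card C \<le> gk_growth scale (span B) n"
proof -
  obtain P where P: "finite P" "products (span B) n \<subseteq> span P"
    using products_subset_span[OF assms(1)] by blast
  obtain E where E: "E \<subseteq> products (span B) n" "independent E" "products (span B) n \<subseteq> span E"
      "card E = dim (products (span B) n)"
    by (rule basis_exists)
  have "finite E"
    using independent_span_bound[OF P(1) E(2)] E(1) P(2) by auto
  then show "finite C" "card C \<le> gk_growth scale (span B) n"
    using independent_span_bound[OF _ assms(2), of E] assms(3) E(3,4)
    by (auto simp: gk_growth_eq)
qed

lemma gk_growth_basis:
  assumes "finite B"
  obtains C where "finite C" "C \<subseteq> products (span B) n" "independent C"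
    "card C = gk_growth scale (span B) n"
proof -
  obtain C where C: "C \<subseteq> products (span B) n" "independent C" "products (span B) n \<subseteq> span C"
      "card C = dim (products (span B) n)"
    by (rule basis_exists)
  then show ?thesis
    using that[of C] card_le_gk_growth(1)[OF assms C(2,1)] by (simp add: gk_growth_eq)
qed

lemma gk_growth_pos:
  assumes "finite B"
  shows "gk_growth scale (span B) n \<ge> 1"
proof -
  have "1 \<in> products (span B) n"
    unfolding products_def by (rule CollectI, rule exI[of _ "[]"]) simp
  then show ?thesis
    using card_le_gk_growth(2)[OF assms, of "{1}" n] by simp
qed

text \<open>A basis of the span of the products of length at most \<open>n\<close>, times independent monomials of
  degree at most \<open>m\<close>, consists of independent products of length at most \<open>n + m\<close>.\<close>

lemma gk_growth_extension:
  assumes D: "subspace D" "1 \<in> D" "\<And>a b. a \<in> D \<Longrightarrow> b \<in> D \<Longrightarrow> a * b \<in> D"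
    and B: "finite B" "span B \<subseteq> D"
    and J: "finite J"
    and A: "finite A" "\<And>u. u \<in> A \<Longrightarrow> set u \<subseteq> J \<and> length u \<le> m"
    and free: "independent_over D (\<lambda>u. prod_list (map y u)) A"
  shows "gk_growth scale (span B) n * card A \<le> gk_growth scale (span (B \<union> y ` J)) (n + m)"
proof -
  obtain C where C: "finite C" "C \<subseteq> products (span B) n" "independent C"
      "card C = gk_growth scale (span B) n"
    by (rule gk_growth_basis[OF B(1)])
  have "prod_list vs \<in> D" if "set vs \<subseteq> span B" for vs
    using that B(2) D(2,3) by (induct vs) auto
  then have CD: "C \<subseteq> D"
    using C(2) by (auto simp: products_def)
  note prods = products_of_independent[OF D(1) A(1) free CD C(3)]
  let ?F = "\<lambda>(b, u). b * prod_list (map y u)"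
  have "?F ` (C \<times> A) \<subseteq> products (span (B \<union> y ` J)) (n + m)"
  proof clarify
    fix b u
    assume bu: "b \<in> C" "u \<in> A"
    then obtain vs where vs: "b = prod_list vs" "set vs \<subseteq> span B" "length vs \<le> n"
      using C(2) by (auto simp: products_def)
    have "set vs \<subseteq> span (B \<union> y ` J)"
      using vs(2) span_mono[of B "B \<union> y ` J"] by auto
    moreover have "set (map y u) \<subseteq> span (B \<union> y ` J)"
      using A(2)[OF bu(2)] by (auto intro: span_base)
    ultimately have "set (vs @ map y u) \<subseteq> span (B \<union> y ` J) \<and> length (vs @ map y u) \<le> n + m"
      using vs(3) A(2)[OF bu(2)] by auto
    then show "b * prod_list (map y u) \<in> products (span (B \<union> y ` J)) (n + m)"
      unfolding products_def vs(1)
      by (intro CollectI exI[of _ "vs @ map y u"]) simp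
  qed
  then have "card (?F ` (C \<times> A)) \<le> gk_growth scale (span (B \<union> y ` J)) (n + m)"
    using B J by (intro card_le_gk_growth(2) prods(2)) auto
  then show ?thesis
    by (simp add: card_image[OF prods(1)] card_cartesian_product C(4))
qed

end

text \<open>A sorted word is given by the multiplicities of its letters, and multiplicities up to \<open>n\<close>
  keep its length at most \<open>n\<close> times the number of letters.\<close>

lemma (in skew_commuting_family) card_words_ge: "Suc n ^ card I \<le> card (words (card I * n))"
proof -
  define word where
    "word a = sorted_list_of_multiset (\<Sum>i\<in>I. replicate_mset (a i) i)" for a :: "'i \<Rightarrow> nat"
  let ?E = "I \<rightarrow>\<^sub>E {..n}"
  have mset_word: "mset (word a) = (\<Sum>i\<in>I. replicate_mset (a i) i)" for a
    by (simp add: word_def)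
  have count: "count (mset (word a)) i = a i" if "i \<in> I" for a i
    using that finite_index by (simp add: mset_word count_sum if_distrib cong: if_cong)
  have "inj_on word ?E"
  proof (rule inj_onI)
    fix a b
    assume ab: "a \<in> ?E" "b \<in> ?E" "word a = word b"
    show "a = b"
      by (rule PiE_ext[OF ab(1,2)]) (metis ab(3) count)
  qed
  moreover have "word ` ?E \<subseteq> words (card I * n)"
  proof clarify
    fix a
    assume a: "a \<in> ?E"
    have "length (word a) = (\<Sum>i\<in>I. a i)"
      by (simp add: mset_word size_multiset_sum flip: size_mset)
    also have "\<dots> \<le> card I * n"
      using sum_bounded_above[of I a n] a by auto
    finally have "length (word a) \<le> card I * n" .
    moreover have "set (word a) \<subseteq> I"
    proof -
      have "set (word a) = set_mset (\<Sum>i\<in>I. replicate_mset (a i) i)"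
        by (simp flip: mset_word)
      also have "\<dots> \<subseteq> I"
        using finite_index by (auto simp: set_mset_sum)
      finally show ?thesis .
    qed
    ultimately show "word a \<in> words (card I * n)"
      by (simp add: words_def word_def)
  qed
  ultimately have "card ?E \<le> card (words (card I * n))"
    using card_inj_on_le finite_words by blast
  then show ?thesis
    by (simp add: card_PiE finite_index)
qed

lemma log_rescale_tendsto_1:
  fixes c :: real
  assumes "c \<ge> 1"
  shows "(\<lambda>n. ln (real n) / ln (c * real n)) \<longlonglongrightarrow> 1"
proof -
  have top: "filterlim (\<lambda>n. ln (c * real n)) at_top sequentially"
    using assms by (intro filterlim_compose[OF ln_at_top]
        filterlim_tendsto_pos_mult_at_top[OF tendsto_const] filterlim_real_sequentially) auto
  have "(\<lambda>n. 1 - ln c / ln (c * real n)) \<longlonglongrightarrow> 1 - 0"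
    by (intro tendsto_diff tendsto_const real_tendsto_divide_at_top[OF tendsto_const top])
  moreover have "eventually (\<lambda>n. 1 - ln c / ln (c * real n) = ln (real n) / ln (c * real n))
      sequentially"
    using eventually_gt_at_top[of 1]
  proof eventually_elim
    case (elim n)
    have "1 < c * real n"
      using assms elim mult_right_mono[of 1 c "real n"]
      by linarith
    then have "ln (c * real n) > 0"
      by simp
    moreover have "ln (c * real n) = ln c + ln (real n)"
      using assms elim by (simp add: ln_mult)
    ultimately show ?case
      by (simp add: field_simps)
  qed
  ultimately show ?thesis
    using tendsto_cong by force
qed

text \<open>Along the subsequence \<open>N = (w + 1) n\<close>, the exponent \<open>log\<^sub>N q(N)\<close> is at least
  \<open>log\<^sub>n p(n) + w\<close> up to the factor \<open>ln n / ln N\<close>, which tends to \<open>1\<close>.\<close>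

lemma limsup_log_growth:
  fixes p q :: "nat \<Rightarrow> nat"
  assumes p: "\<And>n. p n \<ge> 1" and q: "\<And>n. p n * Suc n ^ w \<le> q (Suc w * n)"
  shows "limsup (\<lambda>n. ereal (log (real n) (real (p n)))) + ereal (real w)
    \<le> limsup (\<lambda>n. ereal (log (real n) (real (q n))))"
proof -
  let ?P = "\<lambda>n. ereal (log (real n) (real (p n)))"
  let ?Q = "\<lambda>n. ereal (log (real n) (real (q n)))"
  let ?r = "\<lambda>n. Suc w * n"
  let ?u = "\<lambda>n. ereal (ln (real n) / ln (real (Suc w) * real n))"
  have u: "?u \<longlonglongrightarrow> 1"
    using log_rescale_tendsto_1[of "real (Suc w)"] by (simp add: one_ereal_def)
  have "limsup ?P + ereal (real w) = limsup (\<lambda>n. ?P n + ereal (real w))"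
    by (rule Limsup_add_ereal_right[symmetric]) auto
  also have "\<dots> = limsup (\<lambda>n. ?u n * (?P n + ereal (real w)))"
    by (subst ereal_limsup_lim_mult[OF u]) simp_all
  also have "\<dots> \<le> limsup (?Q \<circ> ?r)"
  proof (rule Limsup_mono)
    show "eventually (\<lambda>n. ?u n * (?P n + ereal (real w)) \<le> (?Q \<circ> ?r) n) sequentially"
      using eventually_gt_at_top[of 1]
    proof eventually_elim
      case (elim n)
      have pos: "ln (real n) > 0" "ln (real (Suc w) * real n) > 0"
        using elim by (auto simp: mult.commute intro!: ln_gt_zero less_1_mult')
      have "real (p n) * real n ^ w \<le> real (p n) * real (Suc n) ^ w"
        by (intro mult_left_mono power_mono) auto
      also have "\<dots> \<le> real (q (?r n))"
        using q[of n] by (metis of_nat_le_iff of_nat_mult of_nat_power)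
      finally have le: "real (p n) * real n ^ w \<le> real (q (?r n))" .
      have "ln (real (p n)) + real w * ln (real n) = ln (real (p n) * real n ^ w)"
        using p[of n] elim by (simp add: ln_mult ln_realpow)
      also have "\<dots> \<le> ln (real (q (?r n)))"
        using p[of n] elim le by (intro ln_mono) auto
      finally have "(ln (real (p n)) + real w * ln (real n)) / ln (real (Suc w) * real n)
          \<le> ln (real (q (?r n))) / ln (real (Suc w) * real n)"
        using pos by (intro divide_right_mono) auto
      moreover have "ln (real n) / ln (real (Suc w) * real n) * (log (real n) (real (p n)) + real w) =
          (ln (real (p n)) + real w * ln (real n)) / ln (real (Suc w) * real n)"
        using pos by (simp add: log_def field_simps)
      ultimately have "ln (real n) / ln (real (Suc w) * real n) *
          (log (real n) (real (p n)) + real w) \<le> log (real (?r n)) (real (q (?r n)))"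
        by (simp only: log_def of_nat_mult)
      then show ?case
        by (simp only: o_def times_ereal.simps plus_ereal.simps ereal_less_eq)
    qed
  qed
  also have "\<dots> \<le> limsup ?Q"
    by (rule limsup_subseq_mono) (simp add: strict_mono_def add_less_le_mono mult_le_mono2 less_imp_le)
  finally show ?thesis .
qed

theorem (in skew_commuting_family) GKdim_ge:
  "GKdim scale D + ereal (real (card I)) \<le> GKdim scale UNIV"
proof -
  have "GKdim scale D \<le> GKdim scale UNIV - ereal (real (card I))"
    unfolding GKdim_def[of scale D]
  proof (rule SUP_least, clarify)
    fix B :: "'h set"
    assume B: "span B \<subseteq> D" "finite B"
    let ?W = "span (B \<union> y ` I)"
    let ?L = "\<lambda>V. limsup (\<lambda>n. ereal (log (real n) (real (gk_growth scale V n))))"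
    have "gk_growth scale (span B) n * Suc n ^ card I \<le> gk_growth scale ?W (Suc (card I) * n)" for n
    proof -
      have "gk_growth scale (span B) n * Suc n ^ card I
          \<le> gk_growth scale (span B) n * card (words (card I * n))"
        by (intro mult_left_mono card_words_ge) simp
      also have "\<dots> \<le> gk_growth scale ?W (n + card I * n)"
        by (rule gk_growth_extension[OF subspace_D one_in_D mult_in_D B(2,1) finite_index
              finite_words _ words_independent_over]) (auto simp: words_def)
      finally show ?thesis by simp
    qed
    then have "?L (span B) + ereal (real (card I)) \<le> ?L ?W"
      by (rule limsup_log_growth[OF gk_growth_pos[OF B(2)]])
    also have "\<dots> \<le> GKdim scale UNIV"
      unfolding GKdim_def
      by (rule SUP_upper) (use B finite_index in \<open>auto intro!: exI[of _ "B \<union> y ` I"]\<close>)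
    finally show "?L (span B) \<le> GKdim scale UNIV - ereal (real (card I))"
      by (simp add: ereal_le_minus)
  qed
  then show ?thesis
    by (simp add: ereal_le_minus)
qed


section \<open>The lower bound\<close>

text \<open>The sum is \<open>n + 1\<close> for \<open>q = 1\<close> and \<open>(q\<^bsup>n + 1\<^esup> - 1) / (q - 1)\<close> otherwise.\<close>

lemma q_number_neq_0:
  fixes q :: "'k::field_char_0"
  assumes "q = 1 \<or> \<not> (\<exists>n>0. q ^ n = 1)"
  shows "(\<Sum>k\<le>n. q ^ k) \<noteq> 0"
proof (cases "q = 1")
  case True
  then show ?thesis
    by (simp flip: of_nat_Suc)
next
  case False
  then have "q ^ Suc n \<noteq> 1"
    using assms by blast
  then show ?thesis
    using False geometric_sum[OF False, of "Suc n"]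
    by (simp only: lessThan_Suc_atMost divide_eq_0_iff right_minus_eq) simp
qed

theorem theorem0p2:
  fixes scale :: "'k::{alg_closed_field, field_char_0} \<Rightarrow> 'h::ring_1 \<Rightarrow> 'h"
    and \<Delta> :: "'h \<Rightarrow> ('h \<times> 'h \<Rightarrow>\<^sub>0 'k)"
    and \<epsilon> :: "'h \<Rightarrow> 'k"
    and S :: "'h \<Rightarrow> 'h"
    and D :: "'h set"
    and w :: nat
    and y :: "nat \<Rightarrow> 'h"
    and lam :: "nat \<Rightarrow> nat \<Rightarrow> 'k"
  assumes "hopf_algebra scale \<Delta> \<epsilon> S"
    and "hopf_subalgebra scale \<Delta> S D"
    and "module.span scale (group_likes scale \<Delta>) \<subseteq> D"
    and "\<And>i. i \<in> {1..w} \<Longrightarrow> skew_primitive scale \<Delta> (y i)"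
    and "lin_indep_mod scale D {1..w} y"
    and "\<And>i j. i \<in> {1..w} \<Longrightarrow> j \<in> {1..w} \<Longrightarrow> i \<le> j \<Longrightarrow>
           lam i j \<noteq> 0 \<and>
           y i * weight scale \<Delta> (y j) = scale (lam i j) (weight scale \<Delta> (y j) * y i)"
    and "\<And>i. i \<in> {1..w} \<Longrightarrow> lam i i = 1 \<or> \<not> (\<exists>n>0. lam i i ^ n = 1)"
  shows "GKdim scale UNIV \<ge> GKdim scale D + ereal (real w)"
proof -
  interpret hopf_algebra scale \<Delta> \<epsilon> S by fact
  have D: "subspace D" "1 \<in> D"
    using assms(2) by (auto simp: hopf_subalgebra_def)
  have wt: "weight scale \<Delta> (y i) \<noteq> 0 \<and>
      tens_eq scale (\<Delta> (weight scale \<Delta> (y i))) (tens (weight scale \<Delta> (y i)) (weight scale \<Delta> (y i))) \<and>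
      tens_eq scale (\<Delta> (y i)) (tens (y i) 1 + tens (weight scale \<Delta> (y i)) (y i))"
    if i: "i \<in> {1..w}" for i
  proof -
    have "y i \<notin> D"
    proof
      assume "y i \<in> D"
      then have "(\<Sum>j\<in>{i}. scale 1 (y j)) \<in> D" by simp
      then have "\<forall>j\<in>{i}. (1::'k) = 0"
        using assms(5) i unfolding lin_indep_mod_def
        by (elim allE[of _ "{i}"] allE[of _ "\<lambda>_. 1"]) auto
      then show False by simp
    qed
    then have not_scalar: "y i \<notin> range (\<lambda>c. scale c 1)"
      using subspace_scale[OF D(1) D(2)] by auto
    obtain g where g: "y i \<noteq> 0" "tens_eq scale (\<Delta> (y i)) (tens (y i) 1 + tens g (y i))"
      using assms(4)[OF i] by (auto simp: skew_primitive_def)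
    show ?thesis
      unfolding weight_eq[OF g]
      using weight_nonzero[OF not_scalar g(2)] weight_comult[OF g] g(2) by simp
  qed
  interpret skew_commuting_family scale \<Delta> \<epsilon> S D "{1..w}" y "\<lambda>i. weight scale \<Delta> (y i)" lam
  proof unfold_locales
    show "hopf_subalgebra scale \<Delta> S D" "lin_indep_mod scale D {1..w} y"
      by fact+
    fix i
    assume i: "i \<in> {1..w}"
    have "weight scale \<Delta> (y i) \<in> group_likes scale \<Delta>"
      using wt[OF i] by (simp add: group_likes_def)
    then show "weight scale \<Delta> (y i) \<in> D"
      using assms(3) span_base by blast
    show "weight scale \<Delta> (y i) \<noteq> 0"
      "tens_eq scale (\<Delta> (weight scale \<Delta> (y i)))
        (tens (weight scale \<Delta> (y i)) (weight scale \<Delta> (y i)))"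
      "tens_eq scale (\<Delta> (y i)) (tens (y i) 1 + tens (weight scale \<Delta> (y i)) (y i))"
      using wt[OF i] by simp_all
    show "(\<Sum>k\<le>n. lam i i ^ k) \<noteq> 0" for n
      by (rule q_number_neq_0[OF assms(7)[OF i]])
    fix j
    assume j: "j \<in> {1..w}" "i \<le> j"
    show "y i * weight scale \<Delta> (y j) = scale (lam i j) (weight scale \<Delta> (y j) * y i)"
      "lam i j \<noteq> 0"
      using assms(6)[OF i j] by simp_all
  qed simp
  show ?thesis
    using GKdim_ge by simp
qed

end
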